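(* Let $G=(V,E)$ be a finite strongly connected simple directed graph with the property that $\mathbb{P}(L(u,v)) = \mathbb{P}(L(u,w))$ for any three distinct vertices $u,v,w\in V$ (that is, a random cover tour starting at any vertex is equally likely to end at any other vertex). Then $G$ is either a cycle with all edges bidirected or a complete graph with all edges bidirected.
   Context: A simple directed graph (digraph) has no loops and at most one edge from $u$ to $v$ for each ordered pair of distinct vertices $(u,v)$; both $uv$ and $vu$ may be edges, where $uv$ denotes the edge directed from $u$ to $v$. A cycle (respectively complete graph) with all edges bidirected is the digraph obtained from an undirected cycle on at least $3$ vertices (respectively an undirected complete graph on at least $1$ vertex) by replacing each undirected edge $\{u,v\}$ with the two directed edges $uv$ and $vu$. The random walk on $G$ moves at each step from its current vertex to an out-neighbor of that vertex chosen uniformly at random, independently of the past. A random cover tour from $u$ is this random walk started at $u$ (the starting vertex $u$ counts as visited) and stopped at the first time it has visited every vertex of $G$; in a finite strongly connected digraph it terminates almost surely. $L(u,v)$ denotes the event that the random cover tour from $u$ ends at $v$, i.e. that $v$ is the last vertex to be visited for the first time. *)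

theory Defs
  imports "HOL-Probability.Probability" "Graph_Theory.Graph_Theory"
begin

definition out_neighbors :: "('a, 'b) pre_digraph \<Rightarrow> 'a \<Rightarrow> 'a set" where
  "out_neighbors G x = {y. (x, y) \<in> arcs_ends G}"

text \<open>A vertex without out-neighbors keeps the walk in place. In a strongly connected digraph
  this only concerns the one-vertex graph, where the cover tour is over at time 0.\<close>

definition walk_step :: "('a, 'b) pre_digraph \<Rightarrow> 'a \<Rightarrow> 'a pmf" where
  "walk_step G x =
     (if out_neighbors G x = {} then return_pmf x else pmf_of_set (out_neighbors G x))"

definition walk_kernel ::
    "('a, 'b) pre_digraph \<Rightarrow> 'a \<Rightarrow> nat \<Rightarrow> (nat \<Rightarrow> 'a) \<Rightarrow> 'a measure" where
  "walk_kernel G u n \<omega> =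
     (case n of 0 \<Rightarrow> measure_pmf (return_pmf u) | Suc m \<Rightarrow> measure_pmf (walk_step G (\<omega> m)))"

text \<open>The law of the trajectory of the random walk from \<open>u\<close>, given by the Ionescu-Tulcea
  theorem; \<open>emeasure_random_walk_path\<close> below confirms its finite-dimensional distributions.\<close>

definition random_walk :: "('a, 'b) pre_digraph \<Rightarrow> 'a \<Rightarrow> (nat \<Rightarrow> 'a) measure" where
  "random_walk G u =
     projective_family.lim UNIV
       (Ionescu_Tulcea.CI (walk_kernel G u) (\<lambda>_. count_space UNIV)) (\<lambda>_. count_space UNIV)"

text \<open>The trajectory \<open>\<omega>\<close> has visited all vertices at time \<open>n\<close>, but not before, and is then at \<open>v\<close>.\<close>

definition cover_tour_ends_at :: "('a, 'b) pre_digraph \<Rightarrow> 'a \<Rightarrow> (nat \<Rightarrow> 'a) \<Rightarrow> bool" where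
  "cover_tour_ends_at G v \<omega> \<longleftrightarrow>
     (\<exists>n. verts G \<subseteq> \<omega> ` {..n} \<and> \<not> verts G \<subseteq> \<omega> ` {..<n} \<and> \<omega> n = v)"

definition last_vertex_event ::
    "('a, 'b) pre_digraph \<Rightarrow> 'a \<Rightarrow> 'a \<Rightarrow> (nat \<Rightarrow> 'a) set" where
  "last_vertex_event G u v = {\<omega> \<in> space (random_walk G u). cover_tour_ends_at G v \<omega>}"

definition bidirected_cycle :: "('a, 'b) pre_digraph \<Rightarrow> bool" where
  "bidirected_cycle G \<longleftrightarrow> digraph G \<and>
     (\<exists>(n::nat) c. 3 \<le> n \<and> bij_betw c {..<n} (verts G) \<and>
        arcs_ends G = (\<Union>i<n. {(c i, c ((i + 1) mod n)), (c ((i + 1) mod n), c i)}))"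

lemma Ionescu_Tulcea_walk_kernel:
  fixes G :: "('a, 'b) pre_digraph"
  shows "Ionescu_Tulcea (walk_kernel G u) (\<lambda>_. count_space UNIV)"
proof (rule Ionescu_Tulcea.intro)
  fix i :: nat
  show "walk_kernel G u i
      \<in> PiM {0..<i} (\<lambda>_. count_space UNIV) \<rightarrow>\<^sub>M subprob_algebra (count_space UNIV)"
  proof (cases i)
    case 0
    show ?thesis
      unfolding 0 walk_kernel_def
      by (auto intro!: measurable_const simp: space_subprob_algebra
          intro: prob_space_imp_subprob_space measure_pmf.prob_space_axioms)
  next
    case (Suc m)
    have "(\<lambda>x. measure_pmf (walk_step G x))
        \<in> count_space UNIV \<rightarrow>\<^sub>M subprob_algebra (count_space UNIV)"
      by (auto simp: space_subprob_algebra
          intro: prob_space_imp_subprob_space measure_pmf.prob_space_axioms)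
    moreover have "(\<lambda>\<omega>. \<omega> m) \<in> PiM {0..<Suc m} (\<lambda>_. count_space UNIV) \<rightarrow>\<^sub>M count_space UNIV"
      by (rule measurable_component_singleton) simp
    ultimately show ?thesis
      unfolding Suc walk_kernel_def by (auto intro: measurable_compose)
  qed
  fix x :: "nat \<Rightarrow> 'a"
  show "prob_space (walk_kernel G u i x)"
    by (auto simp: walk_kernel_def measure_pmf.prob_space_axioms split: nat.split)
qed

lemma sets_random_walk: "sets (random_walk G u) = sets (PiM UNIV (\<lambda>_. count_space UNIV))"
proof -
  interpret Ionescu_Tulcea "walk_kernel G u" "\<lambda>_. count_space UNIV"
    by (rule Ionescu_Tulcea_walk_kernel)
  show ?thesis unfolding random_walk_def by (rule PF.sets_lim)
qed

lemma space_random_walk: "space (random_walk G u) = UNIV"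
  using sets_eq_imp_space_eq[OF sets_random_walk] by (simp add: space_PiM)

lemma emeasure_random_walk_path:
  "emeasure (random_walk G u) {\<omega>. \<forall>i\<le>n. \<omega> i = x i} =
     (if x 0 = u then ennreal (\<Prod>i<n. pmf (walk_step G (x i)) (x (Suc i))) else 0)"
proof -
  interpret IT: Ionescu_Tulcea "walk_kernel G u" "\<lambda>_. count_space UNIV"
    by (rule Ionescu_Tulcea_walk_kernel)
  let ?M = "\<lambda>J. PiM J (\<lambda>_::nat. count_space (UNIV :: 'a set))"
  let ?A = "\<lambda>n. PiE {0..<Suc n} (\<lambda>i. {x i})"
  let ?z = "\<lambda>_::nat. undefined :: 'a"
  have z: "?z \<in> space (?M {0..<0})" by (simp add: space_PiM)
  have A: "?A n \<in> sets (?M {0..<Suc n})" for n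
    by (rule sets_PiM_I_finite) auto
  have main: "emeasure (IT.C 0 (Suc n) ?z) (?A n) =
     (if x 0 = u then ennreal (\<Prod>i<n. pmf (walk_step G (x i)) (x (Suc i))) else 0)"
  proof (induction n)
    case 0
    have "emeasure (IT.C 0 (Suc 0) ?z) (?A 0) = emeasure (IT.eP 0 ?z) (?A 0)"
      using bind_return[OF IT.measurable_eP[of 0] z] by simp
    also have "\<dots> = emeasure (walk_kernel G u 0 ?z) ((\<lambda>y. ?z(0 := y)) -` ?A 0 \<inter> space (count_space UNIV))"
      by (rule IT.emeasure_eP[OF z A])
    also have "(\<lambda>y. ?z(0 := y)) -` ?A 0 \<inter> space (count_space UNIV) = {x 0}"
      by (simp add: vimage_def PiE_iff extensional_def)
    finally show ?case
      by (auto simp: walk_kernel_def emeasure_pmf_single)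
  next
    case (Suc n)
    have sp: "space (IT.C 0 (Suc n) ?z) = space (?M {0..<Suc n})"
      using IT.space_C[OF z, of "Suc n"] by simp
    have eP: "IT.eP (Suc n) \<in> IT.C 0 (Suc n) ?z \<rightarrow>\<^sub>M subprob_algebra (?M {0..<Suc (Suc n)})"
      by (subst measurable_cong_sets[OF IT.sets_C[OF z, of "Suc n"] refl])
         (use IT.measurable_eP[of "Suc n"] in simp)
    have ne: "space (IT.C 0 (Suc n) ?z) \<noteq> {}"
      using IT.prob_space_C[OF z] by (rule prob_space.not_empty)
    have "emeasure (IT.C 0 (Suc (Suc n)) ?z) (?A (Suc n)) =
        emeasure (IT.C 0 (Suc n) ?z \<bind> IT.eP (Suc n)) (?A (Suc n))"
      by simp
    also have "\<dots> = (\<integral>\<^sup>+\<omega>. emeasure (IT.eP (Suc n) \<omega>) (?A (Suc n)) \<partial>IT.C 0 (Suc n) ?z)"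
      by (rule emeasure_bind[OF ne eP A])
    also have "\<dots> = (\<integral>\<^sup>+\<omega>. ennreal (pmf (walk_step G (x n)) (x (Suc n))) * indicator (?A n) \<omega>
        \<partial>IT.C 0 (Suc n) ?z)"
    proof (rule nn_integral_cong)
      fix \<omega> assume "\<omega> \<in> space (IT.C 0 (Suc n) ?z)"
      hence \<omega>: "\<omega> \<in> space (?M {0..<Suc n})" unfolding sp .
      hence ext: "\<omega> \<in> extensional {0..<Suc n}" by (simp add: space_PiM PiE_iff)
      have "fun_upd \<omega> (Suc n) -` ?A (Suc n) \<inter> space (count_space UNIV) =
          (if \<omega> \<in> ?A n then {x (Suc n)} else {})"
      proof -
        have "fun_upd \<omega> (Suc n) y \<in> ?A (Suc n) \<longleftrightarrow> \<omega> \<in> ?A n \<and> y = x (Suc n)" for y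
          using ext by (auto simp: PiE_iff extensional_def atLeastLessThanSuc)
        thus ?thesis by auto
      qed
      moreover have "\<omega> n = x n" if "\<omega> \<in> ?A n"
        using that by (auto simp: PiE_iff)
      ultimately show "emeasure (IT.eP (Suc n) \<omega>) (?A (Suc n)) =
          ennreal (pmf (walk_step G (x n)) (x (Suc n))) * indicator (?A n) \<omega>"
        using IT.emeasure_eP[OF \<omega> A[of "Suc n"]]
        by (auto simp: walk_kernel_def emeasure_pmf_single)
    qed
    also have "\<dots> = pmf (walk_step G (x n)) (x (Suc n)) * emeasure (IT.C 0 (Suc n) ?z) (?A n)"
      using IT.sets_C[OF z, of "Suc n"] A[of n]
      by (intro nn_integral_cmult_indicator) (simp del: IT.C.simps)
    finally show ?case
      unfolding Suc.IH by (simp add: ennreal_mult' mult.commute prod_nonneg)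
  qed
  have up: "IT.up_to {0..<Suc n} = Suc n"
    by (rule antisym) (use IT.up_to_iff[of "{0..<Suc n}"] IT.up_to_less[of "{0..<Suc n}" n] in auto)
  have "{\<omega>. \<forall>i\<le>n. \<omega> i = x i} = prod_emb UNIV (\<lambda>_. count_space UNIV) {0..<Suc n} (?A n)"
    by (auto simp: prod_emb_def PiE_iff less_Suc_eq_le)
  hence "emeasure (random_walk G u) {\<omega>. \<forall>i\<le>n. \<omega> i = x i} = emeasure (IT.CI {0..<Suc n}) (?A n)"
    unfolding random_walk_def using IT.lim[OF _ A[of n]] by simp
  also have "\<dots> = emeasure (distr (IT.C 0 (Suc n) ?z) (?M {0..<Suc n})
      (\<lambda>f. restrict f {0..<Suc n})) (?A n)"
    unfolding IT.CI_def up ..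
  also have "\<dots> = emeasure (IT.C 0 (Suc n) ?z) (?A n)"
    using IT.distr_C[OF le_refl z, of "Suc n"] by simp
  finally show ?thesis unfolding main .
qed

lemma prob_space_random_walk: "prob_space (random_walk G u)"
proof -
  interpret IT: Ionescu_Tulcea "walk_kernel G u" "\<lambda>_. count_space UNIV"
    by (rule Ionescu_Tulcea_walk_kernel)
  have "emeasure IT.PF.lim (IT.PF.emb UNIV {} {\<lambda>_. undefined}) = emeasure (IT.CI {}) {\<lambda>_. undefined}"
    by (rule IT.lim) (auto simp: PiM_empty)
  moreover have "IT.PF.emb UNIV {} {\<lambda>_. undefined} = UNIV"
    by (auto simp: prod_emb_def restrict_def)
  moreover have "prob_space (IT.CI {})" by (rule IT.PF.prob_space_P) simp_all
  moreover have "space (IT.CI {}) = {\<lambda>_. undefined}"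
    by (simp add: IT.CI_def space_PiM)
  ultimately show ?thesis
    by (intro prob_spaceI) (metis prob_space.emeasure_space_1 random_walk_def space_random_walk)
qed

lemma sets_last_vertex_event:
  assumes "finite (verts G)"
  shows "last_vertex_event G u v \<in> sets (random_walk G u)"
proof -
  have *: "{\<omega> \<in> space (random_walk G u). \<omega> n = y} \<in> sets (random_walk G u)" for n y
  proof -
    have "(\<lambda>\<omega>. \<omega> n) \<in> random_walk G u \<rightarrow>\<^sub>M count_space UNIV"
      using measurable_component_singleton[of n UNIV "\<lambda>_. count_space UNIV"]
      by (simp add: measurable_cong_sets[OF sets_random_walk refl])
    from measurable_sets[OF this, of "{y}"] show ?thesis
      by (simp add: vimage_def Int_def conj_commute)
  qed
  have "last_vertex_event G u v = {\<omega> \<in> space (random_walk G u). \<exists>n.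
      (\<forall>x\<in>verts G. \<exists>i\<in>{..n}. \<omega> i = x) \<and> \<not> (\<forall>x\<in>verts G. \<exists>i\<in>{..<n}. \<omega> i = x) \<and> \<omega> n = v}"
    unfolding last_vertex_event_def cover_tour_ends_at_def subset_iff image_iff
    by (simp add: eq_commute Ball_def Bex_def)
  also have "\<dots> \<in> sets (random_walk G u)"
    using assms
    by (intro sets.sets_Collect_countable_Ex sets.sets_Collect_conj sets.sets_Collect_neg
        sets.sets_Collect_finite_All sets.sets_Collect_finite_Ex *) auto
  finally show ?thesis .
qed

end

theory Submission
  imports Defs
begin

text \<open>
  The tour from \<open>u\<close> ends somewhere almost surely, so under the hypothesis it ends at each
  \<open>v \<noteq> u\<close> with probability \<open>1/(n - 1)\<close>. Conditioning on the first step, \<open>P(L(u,v))\<close> is the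
  average over out-neighbours \<open>x\<close> of \<open>u\<close> of \<open>P(L(x,v))\<close> plus the probability that the walk from
  \<open>x\<close> covers \<open>V - {u,v}\<close> and then hits \<open>v\<close> before \<open>u\<close>. Since \<open>P(L(x,v))\<close> equals \<open>1/(n - 1)\<close>
  unless \<open>x = v\<close>, where it vanishes, the second contribution is nonzero iff \<open>uv\<close> is an edge.
  So, for \<open>n \<ge> 3\<close>, \<open>uv\<close> is an edge iff some walk leaves \<open>u\<close>, covers \<open>V - {u,v}\<close> inside that set,
  and then steps to \<open>v\<close>.

  This purely combinatorial property implies that every \<open>G - u\<close> is strongly connected, whence a
  covering walk of \<open>V - {u,v}\<close> can be extended at both ends to go from \<open>v\<close> to \<open>u\<close>: all
  edges are bidirected. Moreover \<open>u\<close> and \<open>v\<close> are adjacent whenever \<open>G - {u,v}\<close> is connected. If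
  \<open>u\<close>, \<open>v\<close> are not adjacent, split \<open>V - {u,v}\<close> into nonempty parts \<open>A\<close>, \<open>B\<close> without edges between
  them. For \<open>x \<in> A\<close> and \<open>y \<in> B\<close> the graph \<open>G - {x,y}\<close> is disconnected, which forces \<open>x\<close> to
  separate \<open>u\<close> from \<open>v\<close> in \<open>A \<union> {u,v}\<close>. Hence a shortest path from \<open>u\<close> to \<open>v\<close> through \<open>A\<close> uses
  all of \<open>A\<close>, likewise for \<open>B\<close>, and the two paths form the whole graph.
\<close>

section \<open>Digraphs whose arcs are determined by covering walks\<close>

text \<open>The last argument is exactly the set of visited vertices, so a walk that covers
  \<open>S\<close> without leaving it is \<open>walk_on R S x y S\<close>.\<close>

inductive walk_on :: "'a rel \<Rightarrow> 'a set \<Rightarrow> 'a \<Rightarrow> 'a \<Rightarrow> 'a set \<Rightarrow> bool" for R S where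
  start: "x \<in> S \<Longrightarrow> walk_on R S x x {x}"
| step: "walk_on R S x y T \<Longrightarrow> (y, z) \<in> R \<Longrightarrow> z \<in> S \<Longrightarrow> walk_on R S x z (insert z T)"

text \<open>Together with \<open>walk_on_seqE\<close> this translates between inductive walks and
  initial pieces of trajectories, the form in which walks meet probabilities.\<close>

lemma walk_on_seqI:
  assumes "\<And>i. i < n \<Longrightarrow> (\<omega> i, \<omega> (Suc i)) \<in> R" "\<And>i. i \<le> n \<Longrightarrow> \<omega> i \<in> S"
  shows "walk_on R S (\<omega> 0) (\<omega> n) (\<omega> ` {..n})"
  using assms
proof (induction n)
  case 0
  then show ?case by (auto intro: walk_on.start)
next
  case (Suc n)
  then have "walk_on R S (\<omega> 0) (\<omega> (Suc n)) (insert (\<omega> (Suc n)) (\<omega> ` {..n}))"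
    by (intro walk_on.step[of R S _ "\<omega> n"]) auto
  then show ?case by (simp add: atMost_Suc)
qed

lemma walk_on_seqE:
  assumes "walk_on R S x y T"
  obtains \<omega> and n :: nat where "\<omega> 0 = x" "\<omega> n = y" "\<omega> ` {..n} = T"
    "\<And>i. i < n \<Longrightarrow> (\<omega> i, \<omega> (Suc i)) \<in> R" "\<And>i. i \<le> n \<Longrightarrow> \<omega> i \<in> S"
  using assms
proof (induction arbitrary: thesis)
  case (start x)
  show ?case by (rule start.prems[of "\<lambda>_. x" 0]) (use start in auto)
next
  case (step x y T z)
  obtain \<omega> and n :: nat where w: "\<omega> 0 = x" "\<omega> n = y" "\<omega> ` {..n} = T"
    "\<And>i. i < n \<Longrightarrow> (\<omega> i, \<omega> (Suc i)) \<in> R" "\<And>i. i \<le> n \<Longrightarrow> \<omega> i \<in> S"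
    using step.IH by metis
  show ?case
  proof (rule step.prems)
    let ?w = "fun_upd \<omega> (Suc n) z"
    show "?w ` {..Suc n} = insert z T" using w(3) by (auto simp: atMost_Suc)
    show "(?w i, ?w (Suc i)) \<in> R" if "i < Suc n" for i
      using that w(2,4) step.hyps by (cases "i = n") auto
    show "?w i \<in> S" if "i \<le> Suc n" for i
      using that w(5) step.hyps by (cases "i = Suc n") auto
  qed (use w in auto)
qed

section \<open>Reachability inside a vertex set\<close>

abbreviation restr :: "'a rel \<Rightarrow> 'a set \<Rightarrow> 'a rel" where
  "restr R S \<equiv> R \<inter> S \<times> S"

lemma restr_rtrancl_mono: "(x, y) \<in> (restr R S)\<^sup>* \<Longrightarrow> S \<subseteq> T \<Longrightarrow> (x, y) \<in> (restr R T)\<^sup>*"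
  by (erule rtrancl_mono[THEN subsetD, rotated]) auto

lemma walk_on_subset: "walk_on R S x y T \<Longrightarrow> x \<in> T \<and> y \<in> T \<and> T \<subseteq> S"
  by (induction rule: walk_on.induct) auto

lemma walk_on_trans:
  assumes "walk_on R S y z T'" "walk_on R S x y T"
  shows "walk_on R S x z (T \<union> T')"
  using assms
proof (induction arbitrary: T rule: walk_on.induct)
  case (start y)
  then have "T \<union> {y} = T" using walk_on_subset by fastforce
  then show ?case using start by simp
next
  case (step y z T' z')
  from walk_on.step[OF step.IH[OF step.prems] step.hyps(2,3)] show ?case by simp
qed

lemma ex_walk_on:
  assumes "(x, y) \<in> (restr R S)\<^sup>*" "x \<in> S"
  shows "\<exists>T. walk_on R S x y T"
  using assms(1)
proof (induction rule: rtrancl_induct)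
  case base
  show ?case using walk_on.start[OF assms(2)] by blast
next
  case (step y z)
  then show ?case using walk_on.step by fastforce
qed

lemma walk_on_reach:
  assumes "walk_on R S x y T" "t \<in> T"
  shows "(x, t) \<in> (restr R S)\<^sup>*" "(t, y) \<in> (restr R S)\<^sup>*"
proof -
  have "(x, t) \<in> (restr R S)\<^sup>* \<and> (t, y) \<in> (restr R S)\<^sup>*"
    using assms
  proof (induction arbitrary: t rule: walk_on.induct)
    case (step x y T z)
    have y: "y \<in> T" "y \<in> S" using walk_on_subset[OF step.hyps(1)] by auto
    have yz: "(y, z) \<in> restr R S" using step.hyps y by auto
    have "(x, y) \<in> (restr R S)\<^sup>*" using step.IH[OF y(1)] by simp
    then show ?case using step.IH step.prems yz by (auto intro: rtrancl_into_rtrancl)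
  qed auto
  then show "(x, t) \<in> (restr R S)\<^sup>*" "(t, y) \<in> (restr R S)\<^sup>*" by auto
qed

text \<open>Vertices are collected one at a time: a walk ending at \<open>y\<close> is prolonged by
  a detour from \<open>y\<close> to a missing vertex and back. All detours stay in \<open>S\<close>,
  so in the end exactly \<open>S\<close> has been visited.\<close>

lemma ex_covering_walk:
  assumes "finite S" and conn: "\<And>a b. a \<in> S \<Longrightarrow> b \<in> S \<Longrightarrow> (a, b) \<in> (restr R S)\<^sup>*"
    and x: "x \<in> S" and y: "y \<in> S"
  shows "walk_on R S x y S"
proof -
  have "\<exists>T. F \<subseteq> T \<and> walk_on R S x y T" if "finite F" "F \<subseteq> S" for F
    using that
  proof (induction rule: finite_induct)
    case empty
    show ?case using ex_walk_on[OF conn[OF x y] x] by auto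
  next
    case (insert a F)
    then obtain T where T: "F \<subseteq> T" "walk_on R S x y T" by auto
    have a: "a \<in> S" using insert.prems by auto
    obtain T1 T2 where T12: "walk_on R S y a T1" "walk_on R S a y T2"
      using ex_walk_on[OF conn[OF y a] y] ex_walk_on[OF conn[OF a y] a] by blast
    have "walk_on R S x y (T \<union> (T1 \<union> T2))"
      by (rule walk_on_trans[OF walk_on_trans[OF T12(2,1)] T(2)])
    moreover have "a \<in> T1" using walk_on_subset[OF T12(1)] by simp
    ultimately show ?case using T(1) by (metis UnCI insert_subset subset_eq)
  qed
  from this[OF assms(1) subset_refl] obtain T where "S \<subseteq> T" "walk_on R S x y T" by auto
  moreover from this have "T = S" using walk_on_subset by (metis subset_antisym)
  ultimately show ?thesis by simp
qed

text \<open>Cut the path at its last visit to \<open>a\<close>; the rest avoids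
  \<open>a\<close>.\<close>

lemma reach_leave:
  assumes "(a, b) \<in> (restr R T)\<^sup>*" "a \<noteq> b"
  obtains z where "(a, z) \<in> R" "z \<in> T - {a}" "(z, b) \<in> (restr R (T - {a}))\<^sup>*"
proof -
  have "a \<noteq> b \<longrightarrow> (\<exists>z. (a, z) \<in> R \<and> z \<in> T - {a} \<and> (z, b) \<in> (restr R (T - {a}))\<^sup>*)"
    using assms(1)
  proof (induction rule: rtrancl_induct)
    case (step y c)
    show ?case
    proof (cases "y = a")
      case True
      then show ?thesis using step.hyps by auto
    next
      case False
      show ?thesis
      proof
        assume "a \<noteq> c"
        then have "(y, c) \<in> restr R (T - {a})" using False step.hyps by auto
        then show "\<exists>z. (a, z) \<in> R \<and> z \<in> T - {a} \<and> (z, c) \<in> (restr R (T - {a}))\<^sup>*"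
          using False step.IH by (metis rtrancl.rtrancl_into_rtrancl)
      qed
    qed
  qed simp
  then show thesis using that assms(2) by blast
qed

text \<open>Time reversal of \<open>reach_leave\<close>: the path is cut at its first visit to
  \<open>b\<close>.\<close>

lemma reach_enter:
  assumes "(a, b) \<in> (restr R T)\<^sup>*" "a \<noteq> b"
  obtains z where "(z, b) \<in> R" "z \<in> T - {b}" "(a, z) \<in> (restr R (T - {b}))\<^sup>*"
proof -
  have conv: "(restr (R\<inverse>) S)\<^sup>* = ((restr R S)\<^sup>*)\<inverse>" for S
    by (subst rtrancl_converse[symmetric]) (rule arg_cong[of _ _ rtrancl], auto)
  have "(b, a) \<in> (restr (R\<inverse>) T)\<^sup>*" unfolding conv using assms(1) by simp
  from reach_leave[OF this assms(2)[symmetric]] obtain z where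
    "(b, z) \<in> R\<inverse>" "z \<in> T - {b}" "(z, a) \<in> (restr (R\<inverse>) (T - {b}))\<^sup>*" .
  then show thesis using that unfolding conv by auto
qed

text \<open>Follow the path until it first meets \<open>C\<close>. By \<open>closed\<close> it
  cannot leave \<open>A\<close> before that. Below, \<open>A\<close> is one side of a separation and
  \<open>C\<close> consists of separating vertices.\<close>

lemma reach_boundary:
  assumes "(z, t) \<in> (restr R T)\<^sup>*" "t \<in> C" "z \<in> A \<union> C"
    and closed: "\<And>a b. (a, b) \<in> R \<Longrightarrow> a \<in> A \<Longrightarrow> b \<in> T \<Longrightarrow> b \<in> A \<union> C"
  shows "\<exists>w\<in>C. (z, w) \<in> (restr R (T \<inter> (A \<union> C)))\<^sup>*"
  using assms(1,3)
proof (induction rule: converse_rtrancl_induct)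
  case base
  then show ?case using assms(2) by auto
next
  case (step y z)
  show ?case
  proof (cases "y \<in> C")
    case False
    then have z: "z \<in> A \<union> C" using step closed by blast
    then have "(y, z) \<in> restr R (T \<inter> (A \<union> C))" using step by auto
    then show ?thesis using step.IH[OF z] by (meson converse_rtrancl_into_rtrancl)
  qed auto
qed

section \<open>Classification of the digraphs that satisfy the covering-walk criterion\<close>

locale covering_digraph =
  fixes V :: "'a set" and R :: "'a rel"
  assumes finite_V: "finite V" and three: "3 \<le> card V"
    and R_subset: "R \<subseteq> V \<times> V" and irrefl: "(x, x) \<notin> R"
    and ex_out: "u \<in> V \<Longrightarrow> \<exists>v. (u, v) \<in> R"
    and arc_iff: "\<lbrakk>u \<in> V; v \<in> V; u \<noteq> v\<rbrakk> \<Longrightarrow> (u, v) \<in> R \<longleftrightarrow>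
      (\<exists>x y. (u, x) \<in> R \<and> walk_on R (V - {u, v}) x y (V - {u, v}) \<and> (y, v) \<in> R)"
begin

lemma arcD: "(x, y) \<in> R \<Longrightarrow> x \<in> V \<and> y \<in> V \<and> x \<noteq> y"
  using R_subset irrefl by auto

text \<open>For an arc from \<open>u\<close> to \<open>x'\<close>, the walk given by
  \<open>arc_iff\<close> meets every vertex other than \<open>u\<close> and \<open>x'\<close>,
  avoids \<open>u\<close>, and can be continued to \<open>x'\<close>. So every vertex reaches every
  out-neighbour of \<open>u\<close> within \<open>V - {u}\<close>. The walk moreover starts at some
  out-neighbour \<open>x\<close> of \<open>u\<close>, and \<open>x\<close> reaches all of
  \<open>V - {u}\<close>; hence \<open>a\<close> reaches \<open>b\<close> through
  \<open>x\<close>.\<close>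

lemma delete_vertex_connected:
  assumes u: "u \<in> V" and a: "a \<in> V - {u}" and b: "b \<in> V - {u}"
  shows "(a, b) \<in> (restr R (V - {u}))\<^sup>*"
proof -
  have walk: "\<exists>x y. (u, x) \<in> R \<and> walk_on R (V - {u, x'}) x y (V - {u, x'}) \<and> (y, x') \<in> R"
    if "(u, x') \<in> R" for x'
    using arc_iff[of u x'] that arcD by metis
  have to_nbr: "(a, x') \<in> (restr R (V - {u}))\<^sup>*" if ux': "(u, x') \<in> R" for x'
  proof (cases "a = x'")
    case False
    obtain x y where w: "walk_on R (V - {u, x'}) x y (V - {u, x'})" "(y, x') \<in> R"
      using walk[OF ux'] by blast
    have "a \<in> V - {u, x'}" using a False by auto
    from walk_on_reach(2)[OF w(1) this] have "(a, y) \<in> (restr R (V - {u}))\<^sup>*"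
      by (rule restr_rtrancl_mono) auto
    moreover have "(y, x') \<in> restr R (V - {u})"
      using w arcD ux' walk_on_subset[OF w(1)] by auto
    ultimately show ?thesis by (rule rtrancl_into_rtrancl)
  qed simp
  obtain x0 where x0: "(u, x0) \<in> R" using ex_out[OF u] by blast
  then obtain x y where w: "(u, x) \<in> R" "walk_on R (V - {u, x0}) x y (V - {u, x0})" "(y, x0) \<in> R"
    using walk by blast
  have xs: "(x, s) \<in> (restr R (V - {u}))\<^sup>*" if "s \<in> V - {u, x0}" for s
    using walk_on_reach(1)[OF w(2) that] by (rule restr_rtrancl_mono) auto
  have "(x, b) \<in> (restr R (V - {u}))\<^sup>*"
  proof (cases "b = x0")
    case True
    have y: "y \<in> V - {u, x0}" using walk_on_subset[OF w(2)] by auto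
    then have "(y, x0) \<in> restr R (V - {u})" using w(3) arcD x0 by auto
    with xs[OF y] show ?thesis unfolding True by (rule rtrancl_into_rtrancl)
  qed (use xs b in auto)
  with to_nbr[OF w(1)] show ?thesis by (rule rtrancl_trans)
qed

lemma arc_sym:
  assumes uv: "(u, v) \<in> R"
  shows "(v, u) \<in> R"
proof -
  let ?S = "V - {u, v}"
  have V: "u \<in> V" "v \<in> V" "u \<noteq> v" using arcD[OF uv] by auto
  obtain x y where w: "walk_on R ?S x y ?S"
    using arc_iff[OF V] uv by blast
  have xy: "x \<in> ?S" "y \<in> ?S" using walk_on_subset[OF w] by auto
  \<comment> \<open>A path from \<open>v\<close> to \<open>x\<close> in G - u, cut at its last visit
    to \<open>v\<close>, leads from an out-neighbour of \<open>v\<close> to the start of the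
    covering walk. Symmetrically, a path from \<open>y\<close> to \<open>u\<close> in G - v leads
    from its end to an in-neighbour of \<open>u\<close>. Both pieces avoid \<open>u\<close> and
    \<open>v\<close>.\<close>
  obtain z where z: "(v, z) \<in> R" "z \<in> V - {u} - {v}" "(z, x) \<in> (restr R (V - {u} - {v}))\<^sup>*"
    by (rule reach_leave[OF delete_vertex_connected[of u v x]]) (use V xy in auto)
  obtain z' where z': "(z', u) \<in> R" "z' \<in> V - {v} - {u}" "(y, z') \<in> (restr R (V - {v} - {u}))\<^sup>*"
    by (rule reach_enter[OF delete_vertex_connected[of v y u]]) (use V xy in auto)
  have S: "V - {u} - {v} = ?S" "V - {v} - {u} = ?S" "V - {v, u} = ?S" by auto
  obtain T1 T2 where T: "walk_on R ?S z x T1" "walk_on R ?S y z' T2"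
    using ex_walk_on[OF z(3)[unfolded S] z(2)[unfolded S]] ex_walk_on[OF z'(3)[unfolded S] xy(2)]
    by blast
  have "walk_on R ?S z z' (T1 \<union> (?S \<union> T2))"
    by (rule walk_on_trans[OF walk_on_trans[OF T(2) w] T(1)])
  moreover have "T1 \<union> (?S \<union> T2) = ?S"
    using walk_on_subset[OF T(1)] walk_on_subset[OF T(2)] by blast
  ultimately show ?thesis
    using arc_iff[OF V(2,1) V(3)[symmetric]] z(1) z'(1) unfolding S by auto
qed

lemma reach_sym: "(x, y) \<in> (restr R S)\<^sup>* \<Longrightarrow> (y, x) \<in> (restr R S)\<^sup>*"
  using sym_rtrancl[of "restr R S"] arc_sym by (auto simp: sym_def)

text \<open>Connectedness supplies a covering walk between any two vertices of
  \<open>V - {u, v}\<close>. Suitable ends are an out-neighbour of \<open>u\<close> and an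
  in-neighbour of \<open>v\<close>, found on paths from \<open>u\<close> to a third vertex
  \<open>s\<close> in G - v and from \<open>s\<close> to \<open>v\<close> in G - u.\<close>

lemma arc_if_connected:
  assumes V: "u \<in> V" "v \<in> V" "u \<noteq> v"
    and conn: "\<And>a b. a \<in> V - {u, v} \<Longrightarrow> b \<in> V - {u, v} \<Longrightarrow> (a, b) \<in> (restr R (V - {u, v}))\<^sup>*"
  shows "(u, v) \<in> R"
proof -
  have S: "V - {v} - {u} = V - {u, v}" "V - {u} - {v} = V - {u, v}" by auto
  have "\<not> V \<subseteq> {u, v}" using three card_mono[of "{u, v}" V] V(3) by auto
  then obtain s where s: "s \<in> V" "s \<noteq> u" "s \<noteq> v" by auto
  obtain x where x: "(u, x) \<in> R" "x \<in> V - {v} - {u}"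
    by (rule reach_leave[OF delete_vertex_connected[of v u s]]) (use V s in auto)
  obtain y where y: "(y, v) \<in> R" "y \<in> V - {u} - {v}"
    by (rule reach_enter[OF delete_vertex_connected[of u s v]]) (use V s in auto)
  have "walk_on R (V - {u, v}) x y (V - {u, v})"
    by (rule ex_covering_walk[OF _ conn]) (use finite_V x y in auto)
  then show ?thesis using arc_iff[OF V] x(1) y(1) by blast
qed

text \<open>If \<open>u\<close> and \<open>v\<close> were still joined on the \<open>A\<close> side
  without \<open>x\<close>, then G - {x,y} would be connected, since each of its vertices reaches
  \<open>u\<close> or \<open>v\<close> on its own side. By \<open>arc_if_connected\<close> there
  would be an arc from \<open>x\<close> to \<open>y\<close>, that is, from \<open>A\<close> to
  \<open>B\<close>.\<close>

lemma separated_by_each_vertex: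
  assumes V: "u \<in> V" "v \<in> V" and AB: "V - {u, v} = A \<union> B" "A \<inter> B = {}"
    and no_arc: "\<And>a b. a \<in> A \<Longrightarrow> b \<in> B \<Longrightarrow> (a, b) \<notin> R"
    and y: "y \<in> B" and x: "x \<in> A"
  shows "(u, v) \<notin> (restr R (A \<union> {u, v} - {x}))\<^sup>*"
proof
  assume uv: "(u, v) \<in> (restr R (A \<union> {u, v} - {x}))\<^sup>*"
  let ?D = "V - {x, y}"
  have xyV: "x \<in> V" "y \<in> V" "x \<noteq> y" "x \<noteq> u" "x \<noteq> v" "y \<noteq> u" "y \<noteq> v"
    using x y AB by auto
  have uvD: "(u, v) \<in> (restr R ?D)\<^sup>*"
    by (rule restr_rtrancl_mono[OF uv]) (use AB V xyV y in auto)
  have to_u: "(z, u) \<in> (restr R ?D)\<^sup>*" if z: "z \<in> ?D" for z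
  proof -
    have "\<exists>w\<in>{u, v}. (z, w) \<in> (restr R ?D)\<^sup>*"
    proof (cases "z \<in> A \<union> {u, v}")
      case True
      \<comment> \<open>Only \<open>x\<close> is deleted here. Stopping at the first visit to
        \<open>u\<close> or \<open>v\<close> keeps the path out of \<open>B\<close>, and hence away
        from \<open>y\<close>.\<close>
      have "(z, u) \<in> (restr R (V - {x}))\<^sup>*"
        using delete_vertex_connected[of x z u] xyV V z by auto
      then have "\<exists>w\<in>{u, v}. (z, w) \<in> (restr R ((V - {x}) \<inter> (A \<union> {u, v})))\<^sup>*"
      proof (rule reach_boundary[OF _ _ True])
        show "b \<in> A \<union> {u, v}" if "(a, b) \<in> R" "a \<in> A" "b \<in> V - {x}" for a b
          using that no_arc AB(1) by blast
      qed simp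
      moreover have "(V - {x}) \<inter> (A \<union> {u, v}) \<subseteq> ?D" using y AB xyV by auto
      ultimately show ?thesis using restr_rtrancl_mono by metis
    next
      case False
      then have zB: "z \<in> B \<union> {u, v}" using z AB by auto
      have "(z, u) \<in> (restr R (V - {y}))\<^sup>*"
        using delete_vertex_connected[of y z u] xyV V z by auto
      then have "\<exists>w\<in>{u, v}. (z, w) \<in> (restr R ((V - {y}) \<inter> (B \<union> {u, v})))\<^sup>*"
      proof (rule reach_boundary[OF _ _ zB])
        show "b \<in> B \<union> {u, v}" if "(a, b) \<in> R" "a \<in> B" "b \<in> V - {y}" for a b
          using that no_arc AB(1) arc_sym by blast
      qed simp
      moreover have "(V - {y}) \<inter> (B \<union> {u, v}) \<subseteq> ?D" using x AB xyV by auto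
      ultimately show ?thesis using restr_rtrancl_mono by metis
    qed
    then show ?thesis using reach_sym[OF uvD] by (auto intro: rtrancl_trans)
  qed
  have "(x, y) \<in> R"
  proof (rule arc_if_connected[OF xyV(1-3)])
    fix a b assume "a \<in> ?D" "b \<in> ?D"
    then show "(a, b) \<in> (restr R ?D)\<^sup>*"
      by (rule rtrancl_trans[OF to_u reach_sym[OF to_u]])
  qed
  then show False using no_arc x y by blast
qed

text \<open>Take a shortest path from \<open>u\<close> to \<open>v\<close> within \<open>A\<close>
  and its two ends. Minimality excludes repetitions and chords, and by
  \<open>separated_by_each_vertex\<close> the path cannot miss a vertex of \<open>A\<close>.\<close>

lemma component_path:
  assumes V: "u \<in> V" "v \<in> V" "u \<noteq> v" and AB: "V - {u, v} = A \<union> B" "A \<inter> B = {}"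
    and no_arc: "\<And>a b. a \<in> A \<Longrightarrow> b \<in> B \<Longrightarrow> (a, b) \<notin> R"
    and A: "A \<noteq> {}" and B: "B \<noteq> {}"
  obtains f and n :: nat where "f 0 = u" "f n = v" "bij_betw f {..n} (A \<union> {u, v})"
    "\<And>i. i < n \<Longrightarrow> (f i, f (Suc i)) \<in> R"
    "\<And>i j. \<lbrakk>i \<le> n; j \<le> n; (f i, f j) \<in> R\<rbrakk> \<Longrightarrow> j = Suc i \<or> i = Suc j"
proof -
  let ?F = "A \<union> {u, v}"
  let ?Q = "restr R ?F"
  obtain a where a: "a \<in> A" using A by auto
  \<comment> \<open>After deleting \<open>w'\<close>, the only exit from \<open>A\<close> is
    \<open>w\<close>, so a path from \<open>a\<close> to \<open>w\<close> can be stopped there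
    without entering \<open>B\<close>.\<close>
  have reach: "(a, w) \<in> ?Q\<^sup>*" if w: "{w, w'} = {u, v}" for w w'
  proof -
    have ww': "w \<noteq> w'" "w \<in> V" "w' \<in> V" using w V by (auto simp: doubleton_eq_iff)
    have "a \<in> V - {w'}" using a AB w by auto
    then have "(a, w) \<in> (restr R (V - {w'}))\<^sup>*"
      using delete_vertex_connected[of w' a w] ww' by auto
    then have "\<exists>t\<in>{w}. (a, t) \<in> (restr R ((V - {w'}) \<inter> (A \<union> {w})))\<^sup>*"
    proof (rule reach_boundary)
      show "c \<in> A \<union> {w}" if "(b, c) \<in> R" "b \<in> A" "c \<in> V - {w'}" for b c
        using that no_arc AB(1) w by blast
    qed (use a in auto)
    then have "(a, w) \<in> (restr R ((V - {w'}) \<inter> (A \<union> {w})))\<^sup>*" by simp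
    then show ?thesis by (rule restr_rtrancl_mono) (use w in auto)
  qed
  have "(u, v) \<in> ?Q\<^sup>*"
    using reach_sym[OF reach[of u v]] reach[of v u] by (auto intro: rtrancl_trans)
  then have ex: "\<exists>n. (u, v) \<in> ?Q ^^ n" by (simp add: rtrancl_power)
  define n where "n = (LEAST n. (u, v) \<in> ?Q ^^ n)"
  have n: "(u, v) \<in> ?Q ^^ n" unfolding n_def using ex by (rule LeastI_ex)
  have n_le: "n \<le> k" if "(u, v) \<in> ?Q ^^ k" for k
    unfolding n_def using that by (rule Least_le)
  obtain f where f: "f 0 = u" "f n = v" "\<And>i. i < n \<Longrightarrow> (f i, f (Suc i)) \<in> ?Q"
    using n by (auto simp: relpow_fun_conv)
  have seg: "(f i, f (i + k)) \<in> ?Q ^^ k" if "i + k \<le> n" for i k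
    unfolding relpow_fun_conv using that f(3) by (intro exI[of _ "\<lambda>l. f (i + l)"]) auto
  \<comment> \<open>Splicing a connection of length \<open>k\<close> between the two path vertices
    gives a path from \<open>u\<close> to \<open>v\<close> of length \<open>i + k + (n - j)\<close>,
    which is at least \<open>n\<close>. The case \<open>k = 1\<close> controls chords and
    \<open>k = 0\<close> repetitions.\<close>
  have no_shortcut: "j \<le> i + k" if ij: "i \<le> n" "j \<le> n" and k: "(f i, f j) \<in> ?Q ^^ k" for i j k
  proof -
    have "(u, f i) \<in> ?Q ^^ i" "(f j, v) \<in> ?Q ^^ (n - j)"
      using seg[of 0 i] seg[of j "n - j"] ij f by auto
    with k have "(u, v) \<in> ?Q ^^ (i + k + (n - j))"
      unfolding relpow_add by blast
    from n_le[OF this] ij show ?thesis by linarith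
  qed
  have fF: "f i \<in> ?F" if "i \<le> n" for i
    using that f(1,2) f(3)[of i] by (cases "i = n") auto
  show thesis
  proof (rule that[of f n])
    show "(f i, f (Suc i)) \<in> R" if "i < n" for i using f(3)[OF that] by auto
    show "j = Suc i \<or> i = Suc j" if ij: "i \<le> n" "j \<le> n" and "(f i, f j) \<in> R" for i j
    proof -
      have "(f i, f j) \<in> ?Q ^^ 1" "(f j, f i) \<in> ?Q ^^ 1"
        using that fF arc_sym by auto
      then have "j \<le> i + 1" "i \<le> j + 1" using no_shortcut ij by blast+
      moreover have "i \<noteq> j" using that irrefl by auto
      ultimately show ?thesis by linarith
    qed
    have "inj_on f {..n}"
    proof (rule inj_onI)
      fix i j assume ij: "i \<in> {..n}" "j \<in> {..n}" "f i = f j"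
      then have "j \<le> i + 0" "i \<le> j + 0"
        using no_shortcut[of i j 0] no_shortcut[of j i 0] by auto
      then show "i = j" by simp
    qed
    moreover have "?F \<subseteq> f ` {..n}"
    proof
      fix x assume x: "x \<in> ?F"
      show "x \<in> f ` {..n}"
      proof (rule ccontr)
        assume nx: "x \<notin> f ` {..n}"
        with f(1,2) have "x \<noteq> u" "x \<noteq> v" by force+
        with x have xA: "x \<in> A" by auto
        have "(f i, f (Suc i)) \<in> restr R (?F - {x})" if "i < n" for i
          using f(3)[OF that] nx that by auto
        then have "(u, v) \<in> (restr R (?F - {x})) ^^ n"
          unfolding relpow_fun_conv using f by (intro exI[of _ f]) auto
        then have "(u, v) \<in> (restr R (?F - {x}))\<^sup>*" by (rule relpow_imp_rtrancl)
        moreover obtain y where "y \<in> B" using B by auto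
        ultimately show False
          using separated_by_each_vertex[OF V(1,2) AB no_arc _ xA] by blast
      qed
    qed
    ultimately show "bij_betw f {..n} ?F" using fF by (auto simp: bij_betw_def)
  qed (use f in auto)
qed

lemma cycle_if_not_complete:
  assumes V: "u \<in> V" "v \<in> V" "u \<noteq> v" and uv: "(u, v) \<notin> R"
  shows "\<exists>(N::nat) c. 3 \<le> N \<and> bij_betw c {..<N} V \<and>
    R = (\<Union>i<N. {(c i, c ((i + 1) mod N)), (c ((i + 1) mod N), c i)})"
proof -
  let ?S = "V - {u, v}"
  obtain a b where ab: "a \<in> ?S" "b \<in> ?S" "(a, b) \<notin> (restr R ?S)\<^sup>*"
    using arc_if_connected[OF V] uv by blast
  \<comment> \<open>\<open>A\<close> is the part of G - {u,v} reachable from \<open>a\<close>. It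
    misses \<open>b\<close>, so both parts are nonempty, and no arc leaves it for
    \<open>B\<close>.\<close>
  define A where "A = {x \<in> ?S. (a, x) \<in> (restr R ?S)\<^sup>*}"
  define B where "B = ?S - A"
  have AB: "?S = A \<union> B" "A \<inter> B = {}" "V - {v, u} = B \<union> A" "B \<inter> A = {}"
    and ne: "A \<noteq> {}" "B \<noteq> {}"
    using ab by (auto simp: A_def B_def)
  have no_arc: "(x, y) \<notin> R" if "x \<in> A" "y \<in> B" for x y
  proof
    assume "(x, y) \<in> R"
    with that have "(x, y) \<in> restr R ?S" "(a, x) \<in> (restr R ?S)\<^sup>*" by (auto simp: A_def B_def)
    then have "(a, y) \<in> (restr R ?S)\<^sup>*" by (meson rtrancl.rtrancl_into_rtrancl)
    with that show False by (auto simp: A_def B_def)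
  qed
  then have no_arc': "(y, x) \<notin> R" if "x \<in> A" "y \<in> B" for x y using that arc_sym by blast
  obtain f n where f: "f 0 = u" "f n = v" "bij_betw f {..n} (A \<union> {u, v})"
    "\<And>i. i < n \<Longrightarrow> (f i, f (Suc i)) \<in> R"
    "\<And>i j. \<lbrakk>i \<le> n; j \<le> n; (f i, f j) \<in> R\<rbrakk> \<Longrightarrow> j = Suc i \<or> i = Suc j"
    by (rule component_path[OF V AB(1,2) no_arc ne]) blast+
  obtain g m where g: "g 0 = v" "g m = u" "bij_betw g {..m} (B \<union> {v, u})"
    "\<And>i. i < m \<Longrightarrow> (g i, g (Suc i)) \<in> R"
    "\<And>i j. \<lbrakk>i \<le> m; j \<le> m; (g i, g j) \<in> R\<rbrakk> \<Longrightarrow> j = Suc i \<or> i = Suc j"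
    by (rule component_path[OF V(2,1) V(3)[symmetric] AB(3,4) no_arc' ne(2,1)]) blast+
  have fin: "finite A" "finite B" using finite_V by (auto simp: A_def B_def)
  have uvAB: "u \<notin> A" "v \<notin> A" "u \<notin> B" "v \<notin> B" by (auto simp: A_def B_def)
  have cn: "n = card A + 1" "m = card B + 1"
    using bij_betw_same_card[OF f(3)] bij_betw_same_card[OF g(3)] fin uvAB V(3) by auto
  have pos: "1 \<le> card A" "1 \<le> card B" using fin ne by (auto simp: Suc_le_eq card_gt_0_iff)
  define N where "N = n + m"
  \<comment> \<open>Run along \<open>f\<close> from \<open>u\<close> to \<open>v\<close>, then along
    \<open>g\<close> back to \<open>u\<close>. The junction \<open>f n = g 0 = v\<close> is counted
    once, and \<open>g m = u\<close> is identified with position 0 by the reduction modulo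
    \<open>N\<close>.\<close>
  define c where "c i = (if i \<le> n then f i else g (i - n))" for i
  have VAB: "V = A \<union> B \<union> {u, v}" using AB(1) V by auto
  have cV: "card V = N"
    unfolding VAB N_def cn using fin uvAB V(3) AB(2) by (simp add: card_Un_disjoint)
  have N: "n < N" "m < N" "3 \<le> N" unfolding N_def using cn pos by auto
  have cf: "c i = f i" if "i \<le> n" for i using that by (simp add: c_def)
  have cg: "c ((n + k) mod N) = g k" if "k \<le> m" for k
  proof (cases "k = m")
    case True
    then show ?thesis using f(1) g(2) by (simp add: N_def c_def)
  next
    case False
    then show ?thesis using that f(2) g(1) by (auto simp: N_def c_def)
  qed
  have F: "f ` {..n} = A \<union> {u, v}" and H: "g ` {..m} = B \<union> {u, v}"
    using f(3) g(3) by (auto simp: bij_betw_def)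
  have img: "c ` {..<N} = V"
  proof
    show "c ` {..<N} \<subseteq> V"
    proof (rule image_subsetI)
      fix i assume "i \<in> {..<N}"
      then have "c i \<in> f ` {..n} \<union> g ` {..m}" by (auto simp: c_def N_def)
      then show "c i \<in> V" unfolding F H VAB by auto
    qed
    have "f i \<in> c ` {..<N}" if "i \<le> n" for i
      using cf[OF that] that N by (intro image_eqI[of _ c i]) auto
    moreover have "g k \<in> c ` {..<N}" if "k \<le> m" for k
      using cg[OF that] N by (intro image_eqI[of _ c "(n + k) mod N"]) auto
    ultimately have "f ` {..n} \<union> g ` {..m} \<subseteq> c ` {..<N}" by auto
    then show "V \<subseteq> c ` {..<N}" unfolding F H VAB by auto
  qed
  \<comment> \<open>A surjection from \<open>N\<close> indices onto the \<open>N\<close> vertices is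
    injective.\<close>
  have "bij_betw c {..<N} V"
    unfolding bij_betw_def using img cV by (auto intro: eq_card_imp_inj_on)
  moreover have "R = (\<Union>i<N. {(c i, c ((i + 1) mod N)), (c ((i + 1) mod N), c i)})" (is "R = ?C")
  proof
    have f_arc: "(f i, f (Suc i)) \<in> ?C \<and> (f (Suc i), f i) \<in> ?C" if "i < n" for i
      using that N cf[of i] cf[of "Suc i"] by (intro conjI UN_I[of i]) auto
    have g_arc: "(g k, g (Suc k)) \<in> ?C \<and> (g (Suc k), g k) \<in> ?C" if "k < m" for k
    proof -
      have "n + k < N" using that by (simp add: N_def)
      then show ?thesis
        using that cg[of k] cg[of "Suc k"] by (intro conjI UN_I[of "n + k"]) auto
    qed
    show "R \<subseteq> ?C"
    proof
      fix p assume p: "p \<in> R"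
      obtain x y where xy: "p = (x, y)" by fastforce
      have "x \<in> V" "y \<in> V" using p xy arcD by auto
      \<comment> \<open>No arc joins \<open>A\<close> to \<open>B\<close>, so both ends of an arc
        lie on the same one of the two paths, where arcs join consecutive vertices only.\<close>
      then have "(x \<in> f ` {..n} \<and> y \<in> f ` {..n}) \<or> (x \<in> g ` {..m} \<and> y \<in> g ` {..m})"
        unfolding F H using no_arc no_arc' p xy VAB by blast
      then show "p \<in> ?C"
      proof
        assume "x \<in> f ` {..n} \<and> y \<in> f ` {..n}"
        then obtain i j where ij: "i \<le> n" "j \<le> n" "x = f i" "y = f j" by auto
        with f(5)[of i j] p xy have "j = Suc i \<or> i = Suc j" by auto
        then show ?thesis using f_arc[of i] f_arc[of j] ij xy by auto
      next
        assume "x \<in> g ` {..m} \<and> y \<in> g ` {..m}"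
        then obtain i j where ij: "i \<le> m" "j \<le> m" "x = g i" "y = g j" by auto
        with g(5)[of i j] p xy have "j = Suc i \<or> i = Suc j" by auto
        then show ?thesis using g_arc[of i] g_arc[of j] ij xy by auto
      qed
    qed
    show "?C \<subseteq> R"
    proof -
      have "(c i, c ((i + 1) mod N)) \<in> R" if "i < N" for i
      proof (cases "i < n")
        case True
        then show ?thesis using f(4)[OF True] N cf[of i] cf[of "Suc i"] by simp
      next
        case False
        define k where "k = i - n"
        have k: "i = n + k" "k < m" using False that by (auto simp: k_def N_def)
        then show ?thesis using g(4)[OF k(2)] cg[of k] cg[of "Suc k"] that by simp
      qed
      then show ?thesis using arc_sym by auto
    qed
  qed
  ultimately show ?thesis using N(3) by blast
qed

end

section \<open>First-step analysis of the walk\<close>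

abbreviation traj_algebra :: "(nat \<Rightarrow> 'a) measure" where
  "traj_algebra \<equiv> PiM UNIV (\<lambda>_. count_space UNIV)"

lemma space_traj_algebra: "space traj_algebra = UNIV"
  by (simp add: space_PiM)

lemma sets_traj_component:
  "{\<omega>. \<omega> i \<in> A} \<in> sets (traj_algebra :: (nat \<Rightarrow> 'a) measure)"
proof -
  have "(\<lambda>\<omega>. \<omega> i) \<in> traj_algebra \<rightarrow>\<^sub>M count_space (UNIV :: 'a set)"
    by (rule measurable_component_singleton) simp
  from measurable_sets[OF this, of A] show ?thesis
    by (simp add: vimage_def space_traj_algebra)
qed

lemma sets_traj_eq: "{\<omega>. \<omega> i = x} \<in> sets (traj_algebra :: (nat \<Rightarrow> 'a) measure)"
  using sets_traj_component[of i "{x}"] by simp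

lemma sets_traj_cylinder:
  "{\<omega>. \<forall>i\<le>n. \<omega> i = x i} \<in> sets (traj_algebra :: (nat \<Rightarrow> 'a) measure)"
proof -
  have "{\<omega>. \<forall>i\<le>n. \<omega> i = x i} = (\<Inter>i\<in>{..n}. {\<omega>. \<omega> i = x i})" by auto
  also have "\<dots> \<in> sets traj_algebra"
    by (rule sets.finite_INT) (auto simp: sets_traj_eq)
  finally show ?thesis .
qed

lemma measurable_case_nat_traj:
  "case_nat u \<in> (traj_algebra :: (nat \<Rightarrow> 'a) measure) \<rightarrow>\<^sub>M traj_algebra"
proof (rule measurable_PiM_single')
  fix i :: nat
  show "(\<lambda>\<omega>. case_nat u \<omega> i) \<in> (traj_algebra :: (nat \<Rightarrow> 'a) measure) \<rightarrow>\<^sub>M count_space UNIV"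
    by (cases i) (auto intro!: measurable_component_singleton)
qed auto

text \<open>Up to a null set the event is a disjoint union of cylinders fixing the coordinates 0 to
  \<open>n\<close>, finitely many because \<open>V\<close> is finite.\<close>

lemma emeasure_finite_dim:
  fixes M :: "(nat \<Rightarrow> 'a) measure"
  assumes sM: "sets M = sets traj_algebra" and V: "finite V"
    and AE: "AE \<omega> in M. \<forall>i. \<omega> i \<in> V" and J: "J \<subseteq> {..n}"
  shows "emeasure M {\<omega>. \<forall>i\<in>J. \<omega> i \<in> A i} =
    (\<Sum>f\<in>{f \<in> PiE {..n} (\<lambda>_. V). \<forall>i\<in>J. f i \<in> A i}. emeasure M {\<omega>. \<forall>i\<le>n. \<omega> i = f i})"
    (is "?L = sum _ ?F")
proof -
  have finJ: "finite J" using J finite_subset by blast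
  have finF: "finite ?F" by (rule finite_subset[of _ "PiE {..n} (\<lambda>_. V)"]) (auto intro!: finite_PiE V)
  have meas: "(\<lambda>f. {\<omega>. \<forall>i\<le>n. \<omega> i = f i}) ` ?F \<subseteq> sets M"
    using sets_traj_cylinder by (auto simp: sM)
  have disj: "disjoint_family_on (\<lambda>f. {\<omega>. \<forall>i\<le>n. \<omega> i = f i}) ?F"
    unfolding disjoint_family_on_def
  proof (intro ballI impI)
    fix f g assume fg: "f \<in> ?F" "g \<in> ?F" "f \<noteq> g"
    { fix \<omega> assume "\<forall>i\<le>n. \<omega> i = f i" "\<forall>i\<le>n. \<omega> i = g i"
      then have "f = g" using fg by (intro PiE_ext[of f "{..n}" "\<lambda>_. V" g]) auto }
    then show "{\<omega>. \<forall>i\<le>n. \<omega> i = f i} \<inter> {\<omega>. \<forall>i\<le>n. \<omega> i = g i} = {}" using fg(3) by blast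
  qed
  have AJ: "{\<omega>. \<forall>i\<in>J. \<omega> i \<in> A i} \<in> sets M"
  proof -
    have "{\<omega>\<in>space traj_algebra. \<forall>i\<in>J. \<omega> i \<in> A i} \<in> sets M" unfolding sM
      by (rule sets.sets_Collect_finite_All[OF _ finJ])
        (simp add: space_traj_algebra sets_traj_component)
    then show ?thesis by (simp add: space_traj_algebra)
  qed
  have "?L = emeasure M (\<Union>f\<in>?F. {\<omega>. \<forall>i\<le>n. \<omega> i = f i})"
  proof (rule emeasure_eq_AE)
    show "AE \<omega> in M. (\<omega> \<in> {\<omega>. \<forall>i\<in>J. \<omega> i \<in> A i}) = (\<omega> \<in> (\<Union>f\<in>?F. {\<omega>. \<forall>i\<le>n. \<omega> i = f i}))"
      using AE
    proof eventually_elim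
      fix \<omega> :: "nat \<Rightarrow> 'a" assume w: "\<forall>i. \<omega> i \<in> V"
      show "(\<omega> \<in> {\<omega>. \<forall>i\<in>J. \<omega> i \<in> A i}) = (\<omega> \<in> (\<Union>f\<in>?F. {\<omega>. \<forall>i\<le>n. \<omega> i = f i}))"
      proof
        assume a: "\<omega> \<in> {\<omega>. \<forall>i\<in>J. \<omega> i \<in> A i}"
        have "restrict \<omega> {..n} \<in> ?F" using w a J by (auto simp: subset_iff)
        then show "\<omega> \<in> (\<Union>f\<in>?F. {\<omega>. \<forall>i\<le>n. \<omega> i = f i})" by (rule UN_I) auto
      qed (use J in auto)
    qed
  qed (use AJ meas finF in auto)
  also have "\<dots> = (\<Sum>f\<in>?F. emeasure M {\<omega>. \<forall>i\<le>n. \<omega> i = f i})"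
    by (rule sum_emeasure[symmetric, OF meas disj finF])
  finally show ?thesis .
qed

text \<open>Reduces the equality of two laws to the cylinder probabilities, which
  \<open>emeasure_random_walk_path\<close> computes for the walk.\<close>

lemma traj_measure_eqI:
  fixes M N :: "(nat \<Rightarrow> 'a) measure"
  assumes M: "sets M = sets traj_algebra" "finite_measure M" "AE \<omega> in M. \<forall>i. \<omega> i \<in> V"
    and N: "sets N = sets traj_algebra" "AE \<omega> in N. \<forall>i. \<omega> i \<in> V"
    and V: "finite V"
    and eq: "\<And>n x. (\<And>i. i \<le> n \<Longrightarrow> x i \<in> V) \<Longrightarrow>
      emeasure M {\<omega>. \<forall>i\<le>n. \<omega> i = x i} = emeasure N {\<omega>. \<forall>i\<le>n. \<omega> i = x i}"
  shows "M = N"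
proof (rule measure_eqI_PiM_infinite[OF M(1) N(1) _ M(2)])
  fix A :: "nat \<Rightarrow> 'a set" and J :: "nat set"
  assume J: "finite J"
  obtain n where n: "J \<subseteq> {..n}" using J finite_nat_set_iff_bounded_le by (auto simp: subset_iff)
  have emb: "prod_emb UNIV (\<lambda>_. count_space UNIV) J (Pi\<^sub>E J A) = {\<omega>. \<forall>i\<in>J. \<omega> i \<in> A i}"
    by (auto simp: prod_emb_def PiE_iff)
  show "emeasure M (prod_emb UNIV (\<lambda>_. count_space UNIV) J (Pi\<^sub>E J A)) =
      emeasure N (prod_emb UNIV (\<lambda>_. count_space UNIV) J (Pi\<^sub>E J A))"
    unfolding emb emeasure_finite_dim[OF M(1) V M(3) n] emeasure_finite_dim[OF N(1) V N(2) n]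
    by (rule sum.cong) (auto intro!: eq simp: PiE_iff)
qed

section \<open>Almost sure confinement and the Markov property\<close>

locale connected_digraph = digraph G for G :: "('a, 'b) pre_digraph" +
  assumes connected: "strongly_connected G"
    and two_verts: "2 \<le> card (verts G)"
begin

abbreviation "V \<equiv> verts G"
abbreviation "E \<equiv> arcs_ends G"
abbreviation "nbrs \<equiv> out_neighbors G"
abbreviation "walk \<equiv> random_walk G"

lemma nbrs_iff: "y \<in> nbrs x \<longleftrightarrow> (x, y) \<in> E"
  by (simp add: out_neighbors_def)

lemma nbrs_subset: "nbrs x \<subseteq> V"
  by (auto simp: out_neighbors_def adj_in_verts)

lemma finite_nbrs: "finite (nbrs x)"
  by (rule finite_subset[OF nbrs_subset]) simp

lemma not_self_nbr: "x \<notin> nbrs x"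
  using adj_not_same by (auto simp: nbrs_iff)

lemma reach: "u \<in> V \<Longrightarrow> v \<in> V \<Longrightarrow> (u, v) \<in> E\<^sup>*"
  using connected by (auto simp: strongly_connected_def intro: reachable_rtranclI)

lemma ex_other_vertex: 
  obtains v where "v \<in> V" "v \<noteq> u"
proof -
  have "\<not> V \<subseteq> {u}"
    using two_verts card_mono[of "{u}" V] by auto
  then show thesis using that by auto
qed

lemma nbrs_nonempty: 
  assumes "u \<in> V" shows "nbrs u \<noteq> {}"
proof -
  obtain v where v: "v \<in> V" "v \<noteq> u" by (rule ex_other_vertex)
  from reach[OF assms v(1)] v(2) obtain w where "(u, w) \<in> E"
    by (metis converse_rtranclE)
  then show ?thesis by (auto simp: out_neighbors_def)
qed

lemma walk_step_eq: "u \<in> V \<Longrightarrow> walk_step G u = pmf_of_set (nbrs u)"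
  using nbrs_nonempty by (simp add: walk_step_def)

lemma set_walk_step: "u \<in> V \<Longrightarrow> set_pmf (walk_step G u) = nbrs u"
  using nbrs_nonempty finite_nbrs by (simp add: walk_step_eq)

lemma sum_walk_step: "u \<in> V \<Longrightarrow> (\<Sum>x\<in>V. pmf (walk_step G u) x) = 1"
  using nbrs_subset by (intro sum_pmf_eq_1) (auto simp: set_walk_step)

lemma prob_space_walk: "prob_space (walk u)"
  by (rule prob_space_random_walk)

lemma AE_start: "AE \<omega> in walk u. \<omega> 0 = u"
proof -
  interpret prob_space "walk u" by (rule prob_space_walk)
  have "emeasure (walk u) {\<omega>. \<omega> 0 = u} = 1"
    using emeasure_random_walk_path[of G u 0 "\<lambda>_. u"] by simp
  then show ?thesis
    by (intro AE_I_eq_1) (auto simp: sets_random_walk sets_traj_eq space_random_walk)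
qed

text \<open>The step probabilities sum to 1 over \<open>V\<close>, so the prolongations of the
  cylinder by a vertex of \<open>V\<close> already carry its whole mass.\<close>

lemma walk_leaves_null:
  assumes u: "u \<in> V" and x: "\<And>i. i \<le> n \<Longrightarrow> x i \<in> V"
  shows "emeasure (walk u) {\<omega>. (\<forall>i\<le>n. \<omega> i = x i) \<and> \<omega> (Suc n) \<notin> V} = 0"
proof -
  interpret prob_space "walk u" by (rule prob_space_walk)
  let ?C = "{\<omega>. \<forall>i\<le>n. \<omega> i = x i}" and ?D = "\<lambda>y. {\<omega>. \<forall>i\<le>Suc n. \<omega> i = (x(Suc n := y)) i}"
  have D: "?D y = {\<omega>. (\<forall>i\<le>n. \<omega> i = x i) \<and> \<omega> (Suc n) = y}" for y
    by (auto simp: le_Suc_eq)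
  have "emeasure (walk u) (\<Union>y\<in>V. ?D y) = (\<Sum>y\<in>V. emeasure (walk u) (?D y))"
  proof (rule sum_emeasure[symmetric])
    show "?D ` V \<subseteq> sets (walk u)" by (auto simp: sets_random_walk simp del: fun_upd_apply intro!: sets_traj_cylinder)
    show "disjoint_family_on ?D V" unfolding D disjoint_family_on_def by blast
  qed simp
  also have "\<dots> = (\<Sum>y\<in>V. emeasure (walk u) ?C * pmf (walk_step G (x n)) y)"
    unfolding emeasure_random_walk_path
    by (intro sum.cong) (auto simp: ennreal_mult prod_nonneg)
  also have "\<dots> = emeasure (walk u) ?C * ennreal (\<Sum>y\<in>V. pmf (walk_step G (x n)) y)"
    by (simp flip: sum_distrib_left)
  also have "\<dots> = emeasure (walk u) ?C"
    using x by (simp add: sum_walk_step)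
  finally have eq: "emeasure (walk u) (\<Union>y\<in>V. ?D y) = emeasure (walk u) ?C" .
  have "{\<omega>. (\<forall>i\<le>n. \<omega> i = x i) \<and> \<omega> (Suc n) \<notin> V} = ?C - (\<Union>y\<in>V. ?D y)"
    unfolding D by auto
  also have "emeasure (walk u) \<dots> = emeasure (walk u) ?C - emeasure (walk u) (\<Union>y\<in>V. ?D y)"
  proof (rule emeasure_Diff)
    show "?C \<in> sets (walk u)" "(\<Union>y\<in>V. ?D y) \<in> sets (walk u)"
      unfolding sets_random_walk
      by (auto simp del: fun_upd_apply intro!: sets.finite_UN sets_traj_cylinder)
    show "(\<Union>y\<in>V. ?D y) \<subseteq> ?C" unfolding D by blast
  qed simp
  finally show ?thesis unfolding eq by simp
qed

lemma AE_in_V: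
  assumes u: "u \<in> V"
  shows "AE \<omega> in walk u. \<forall>i. \<omega> i \<in> V"
proof -
  interpret prob_space "walk u" by (rule prob_space_walk)
  have null: "AE \<omega> in walk u. \<not> ((\<forall>i\<le>n. \<omega> i = x i) \<and> \<omega> (Suc n) \<notin> V)"
    if x: "x \<in> PiE {..n} (\<lambda>_. V)" for n x
  proof (rule AE_I[OF _ walk_leaves_null[OF u, of n x]])
    show "{\<omega>. (\<forall>i\<le>n. \<omega> i = x i) \<and> \<omega> (Suc n) \<notin> V} \<in> sets (walk u)"
    proof -
      have "{\<omega>. (\<forall>i\<le>n. \<omega> i = x i) \<and> \<omega> (Suc n) \<notin> V} = {\<omega>. (\<forall>i\<le>n. \<omega> i = x i)} \<inter> {\<omega>. \<omega> (Suc n) \<in> -V}"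
        by auto
      then show ?thesis
        unfolding sets_random_walk
        using sets.Int[OF sets_traj_cylinder sets_traj_component] by metis
    qed
  qed (use x in auto)
  have "AE \<omega> in walk u. \<forall>i\<le>n. \<omega> i \<in> V" for n
  proof (induction n)
    case 0
    show ?case using AE_start by eventually_elim (use u in simp)
  next
    case (Suc n)
    \<comment> \<open>There are finitely many prefixes inside \<open>V\<close>, so their exceptional
      null sets can be united.\<close>
    have "AE \<omega> in walk u. \<forall>x\<in>PiE {..n} (\<lambda>_. V). \<not> ((\<forall>i\<le>n. \<omega> i = x i) \<and> \<omega> (Suc n) \<notin> V)"
      by (rule AE_finite_allI) (intro finite_PiE null; simp)+
    with Suc.IH show ?case
    proof eventually_elim
      case (elim \<omega>)
      have "restrict \<omega> {..n} \<in> PiE {..n} (\<lambda>_. V)" using elim(1) by auto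
      from elim(2)[rule_format, OF this] have "\<omega> (Suc n) \<in> V" by auto
      with elim(1) show ?case by (auto simp: le_Suc_eq)
    qed
  qed
  then have "AE \<omega> in walk u. \<forall>n. \<forall>i\<le>n. \<omega> i \<in> V" by (simp add: AE_all_countable)
  then show ?thesis by eventually_elim auto
qed

lemma measurable_case_nat_walk: "case_nat u \<in> walk x \<rightarrow>\<^sub>M (traj_algebra :: (nat \<Rightarrow> 'a) measure)"
  using measurable_case_nat_traj by (simp add: measurable_cong_sets[OF sets_random_walk refl])

text \<open>The Markov property at time 1; \<open>case_nat u\<close> prepends \<open>u\<close> to a
  trajectory. Both sides are compared on cylinders, where the first factor of the path probability
  splits off.\<close>

lemma walk_first_step:
  assumes u: "u \<in> V"
  shows "walk u = measure_pmf (walk_step G u) \<bind> (\<lambda>x. distr (walk x) traj_algebra (case_nat u))"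
    (is "_ = ?N")
proof -
  let ?p = "measure_pmf (walk_step G u)" and ?K = "\<lambda>x. distr (walk x) traj_algebra (case_nat u)"
  interpret pu: prob_space "walk u" by (rule prob_space_walk)
  have psK: "prob_space (?K x)" for x
    by (rule prob_space.prob_space_distr[OF prob_space_walk measurable_case_nat_walk])
  have K: "?K \<in> ?p \<rightarrow>\<^sub>M subprob_algebra traj_algebra"
    using psK by (auto simp: space_subprob_algebra prob_space_imp_subprob_space)
  have sN: "sets ?N = sets traj_algebra"
    by (rule sets_bind[OF sets_kernel[OF K]]) auto
  have em: "emeasure ?N X = (\<integral>\<^sup>+x. emeasure (walk x) (case_nat u -` X) \<partial>?p)"
    if "X \<in> sets traj_algebra" for X
    using emeasure_bind[OF _ K that] that
    by (simp add: emeasure_distr[OF measurable_case_nat_walk] space_random_walk)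
  have meas_V: "{\<omega> \<in> space traj_algebra. \<forall>i. \<omega> i \<in> V} \<in> sets traj_algebra"
    by (rule sets.sets_Collect_countable_All) (simp add: space_traj_algebra sets_traj_component)
  have AEN: "AE \<omega> in ?N. \<forall>i. \<omega> i \<in> V"
  proof -
    have "AE \<omega> in ?K x. \<forall>i. \<omega> i \<in> V" if "x \<in> V" for x
    proof (subst AE_distr_iff[OF measurable_case_nat_walk])
      show "{\<omega> \<in> space traj_algebra. \<forall>i. \<omega> i \<in> V} \<in> sets traj_algebra"
        by (rule meas_V)
      show "AE \<omega> in walk x. \<forall>i. case_nat u \<omega> i \<in> V"
        using AE_in_V[OF that] by eventually_elim (auto simp: u split: nat.split)
    qed
    moreover have "AE x in ?p. x \<in> V"
      using nbrs_subset by (auto simp: AE_measure_pmf_iff set_walk_step u)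
    ultimately have "AE x in ?p. AE \<omega> in ?K x. \<forall>i. \<omega> i \<in> V" by auto
    then show ?thesis
      using meas_V by (subst AE_bind[OF K]) (simp_all add: pred_def)
  qed
  show ?thesis
  proof (rule traj_measure_eqI[OF sets_random_walk _ AE_in_V[OF u] sN AEN finite_verts])
    show "finite_measure (walk u)" by unfold_locales
    fix n and x :: "nat \<Rightarrow> 'a"
    show "emeasure (walk u) {\<omega>. \<forall>i\<le>n. \<omega> i = x i} = emeasure ?N {\<omega>. \<forall>i\<le>n. \<omega> i = x i}"
    proof (cases n)
      case 0
      have "case_nat u -` {\<omega>. \<forall>i\<le>0. \<omega> i = x i} = (if x 0 = u then UNIV else {})" by auto
      then show ?thesis
        using prob_space.emeasure_space_1[OF prob_space_walk]
        by (simp add: 0 em[OF sets_traj_cylinder] emeasure_random_walk_path[of G u 0] space_random_walk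
            measure_pmf.emeasure_space_1 del: le_zero_eq)
    next
      case (Suc m)
      have "case_nat u -` {\<omega>. \<forall>i\<le>n. \<omega> i = x i} =
          (if x 0 = u then {\<omega>. \<forall>i\<le>m. \<omega> i = x (Suc i)} else {})"
        unfolding Suc less_Suc_eq_le[symmetric] vimage_def mem_Collect_eq All_less_Suc2 by auto
      then have "emeasure ?N {\<omega>. \<forall>i\<le>n. \<omega> i = x i} =
         (if x 0 = u then \<integral>\<^sup>+y. emeasure (walk y) {\<omega>. \<forall>i\<le>m. \<omega> i = x (Suc i)} \<partial>?p else 0)"
        by (simp add: em[OF sets_traj_cylinder])
      \<comment> \<open>Only the walk started at \<open>x (Suc 0)\<close> gives the shifted cylinder
        positive mass.\<close>
      also have "(\<integral>\<^sup>+y. emeasure (walk y) {\<omega>. \<forall>i\<le>m. \<omega> i = x (Suc i)} \<partial>?p) =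
        (\<integral>\<^sup>+y. ennreal (\<Prod>i<m. pmf (walk_step G (x (Suc i))) (x (Suc (Suc i)))) * indicator {x (Suc 0)} y \<partial>?p)"
        by (intro nn_integral_cong) (auto simp: emeasure_random_walk_path indicator_def)
      also have "\<dots> = ennreal (\<Prod>i<m. pmf (walk_step G (x (Suc i))) (x (Suc (Suc i)))) *
           pmf (walk_step G u) (x (Suc 0))"
        by (subst nn_integral_cmult_indicator) (auto simp: emeasure_pmf_single)
      finally show ?thesis
        by (simp add: emeasure_random_walk_path Suc prod.lessThan_Suc_shift ennreal_mult prod_nonneg mult.commute
            del: prod.lessThan_Suc)
    qed
  qed
qed

lemma measure_first_step:
  assumes u: "u \<in> V" and X: "X \<in> sets traj_algebra"
  shows "measure (walk u) X =
    (\<Sum>x\<in>nbrs u. measure (walk x) (case_nat u -` X)) / card (nbrs u)"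
proof -
  let ?p = "measure_pmf (walk_step G u)" and ?K = "\<lambda>x. distr (walk x) traj_algebra (case_nat u)"
  have psK: "prob_space (?K x)" for x
    by (rule prob_space.prob_space_distr[OF prob_space_walk measurable_case_nat_walk])
  have K: "?K \<in> ?p \<rightarrow>\<^sub>M subprob_algebra traj_algebra"
    using psK by (auto simp: space_subprob_algebra prob_space_imp_subprob_space)
  have "measure (walk u) X = (\<integral>x. measure (?K x) X \<partial>?p)"
    unfolding walk_first_step[OF u] by (rule measure_pmf.measure_bind[OF K X])
  also have "\<dots> = (\<integral>x. measure (walk x) (case_nat u -` X) \<partial>?p)"
    by (simp add: measure_distr[OF measurable_case_nat_walk X] space_random_walk)
  also have "\<dots> = (\<Sum>x\<in>nbrs u. measure (walk x) (case_nat u -` X)) / card (nbrs u)"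
    unfolding walk_step_eq[OF u] by (rule integral_pmf_of_set[OF nbrs_nonempty[OF u] finite_nbrs])
  finally show ?thesis .
qed

end

section \<open>The last vertex visited\<close>

text \<open>With \<open>v\<close> in \<open>A\<close>, the time \<open>n\<close> is the first entry
  into \<open>A\<close>. For \<open>A = {v}\<close> and \<open>S = V - {v}\<close> this is the event
  that the tour ends at \<open>v\<close>. For \<open>A = {u, v}\<close> and
  \<open>S = V - {u, v}\<close> the walk covers all the rest and then hits \<open>v\<close> before
  \<open>u\<close>.\<close>

definition first_hit :: "'a set \<Rightarrow> 'a set \<Rightarrow> 'a \<Rightarrow> (nat \<Rightarrow> 'a) set" where
  "first_hit S A v = {\<omega>. \<exists>n. \<omega> n = v \<and> (\<forall>i<n. \<omega> i \<notin> A) \<and> S \<subseteq> \<omega> ` {..<n}}"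

lemma sets_first_hit:
  assumes "finite S"
  shows "first_hit S A v \<in> sets traj_algebra"
proof -
  have *: "{\<omega> \<in> space traj_algebra. \<omega> i \<in> B} \<in> sets traj_algebra" for i and B :: "'a set"
    by (simp add: space_traj_algebra sets_traj_component)
  have "first_hit S A v = {\<omega> \<in> space traj_algebra. \<exists>n. \<omega> n \<in> {v} \<and> (\<forall>i\<in>{..<n}. \<omega> i \<in> -A)
      \<and> (\<forall>s\<in>S. \<exists>i\<in>{..<n}. \<omega> i \<in> {s})}"
    unfolding first_hit_def subset_iff image_iff by (simp add: space_traj_algebra Ball_def Bex_def eq_commute)
  also have "\<dots> \<in> sets traj_algebra"
    using assms
    by (intro sets.sets_Collect_countable_Ex sets.sets_Collect_conj
        sets.sets_Collect_finite_All sets.sets_Collect_finite_Ex *) auto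
  finally show ?thesis .
qed

text \<open>Prepending \<open>u\<close> shifts time by one and removes \<open>u\<close> from the
  vertices still to be covered; \<open>u \<noteq> v\<close> rules out a hit at time 0.\<close>

lemma vimage_first_hit:
  assumes "u \<noteq> v" "u \<notin> A"
  shows "case_nat u -` first_hit S A v = first_hit (S - {u}) A v"
proof -
  have *: "(\<exists>n. case_nat u \<omega> n = v \<and> (\<forall>i<n. case_nat u \<omega> i \<notin> A) \<and> S \<subseteq> case_nat u \<omega> ` {..<n}) \<longleftrightarrow>
    (\<exists>n. \<omega> n = v \<and> (\<forall>i<n. \<omega> i \<notin> A) \<and> S - {u} \<subseteq> \<omega> ` {..<n})" (is "?L \<longleftrightarrow> ?R") for \<omega>
  proof -
    have img: "case_nat u \<omega> ` {..<Suc m} = insert u (\<omega> ` {..<m})" for m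
      unfolding lessThan_Suc_eq_insert_0 by (simp add: image_image)
    have "?L \<longleftrightarrow> (\<exists>m. case_nat u \<omega> (Suc m) = v \<and> (\<forall>i<Suc m. case_nat u \<omega> i \<notin> A)
        \<and> S \<subseteq> case_nat u \<omega> ` {..<Suc m})"
      using assms(1) by (metis nat.case(1) not0_implies_Suc)
    also have "\<dots> \<longleftrightarrow> ?R"
      unfolding img All_less_Suc2 using assms(2) by (auto simp: subset_insert_iff)
    finally show ?thesis .
  qed
  then show ?thesis by (auto simp: first_hit_def)
qed

text \<open>Distinguish whether \<open>u\<close> occurs before the first visit to
  \<open>v\<close>.\<close>

lemma first_hit_split:
  assumes "u \<noteq> v"
  shows "first_hit (W - {v} - {u}) {v} v = first_hit (W - {v}) {v} v \<union> first_hit (W - {u, v}) {u, v} v"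
proof -
  have W: "W - {v} - {u} = W - {u, v}" by auto
  show ?thesis unfolding W first_hit_def
  proof (intro equalityI subsetI)
    fix \<omega> assume "\<omega> \<in> {\<omega>. \<exists>n. \<omega> n = v \<and> (\<forall>i<n. \<omega> i \<notin> {v}) \<and> W - {u, v} \<subseteq> \<omega> ` {..<n}}"
    then obtain n where n: "\<omega> n = v" "\<forall>i<n. \<omega> i \<notin> {v}" "W - {u, v} \<subseteq> \<omega> ` {..<n}" by blast
    show "\<omega> \<in> {\<omega>. \<exists>n. \<omega> n = v \<and> (\<forall>i<n. \<omega> i \<notin> {v}) \<and> W - {v} \<subseteq> \<omega> ` {..<n}} \<union>
       {\<omega>. \<exists>n. \<omega> n = v \<and> (\<forall>i<n. \<omega> i \<notin> {u, v}) \<and> W - {u, v} \<subseteq> \<omega> ` {..<n}}"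
    proof (cases "u \<in> \<omega> ` {..<n}")
      case True
      with n(3) have "W - {v} \<subseteq> \<omega> ` {..<n}" by auto
      then show ?thesis using n by blast
    next
      case False
      then have "\<forall>i<n. \<omega> i \<notin> {u, v}" using n(2) by auto
      then show ?thesis using n by blast
    qed
  qed auto
qed

lemma first_hit_disjoint:
  assumes "u \<in> W" "u \<noteq> v"
  shows "first_hit (W - {v}) {v} v \<inter> first_hit (W - {u, v}) {u, v} v = {}"
proof -
  have False if n: "\<omega> n = v" "\<forall>i<n. \<omega> i \<notin> {v}" "W - {v} \<subseteq> \<omega> ` {..<n}"
    and m: "\<omega> m = v" "\<forall>i<m. \<omega> i \<notin> {u, v}" for \<omega> and m n :: nat
  proof -
    have "m = n" using n m by (metis insertCI linorder_neqE_nat)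
    moreover have "u \<in> \<omega> ` {..<n}" using assms n(3) by blast
    ultimately show False using m(2) by auto
  qed
  then show ?thesis unfolding first_hit_def by blast
qed

section \<open>The distribution of the final vertex\<close>

context connected_digraph
begin

definition last_prob :: "'a \<Rightarrow> 'a \<Rightarrow> real" where
  "last_prob u v = measure (walk u) (last_vertex_event G u v)"

text \<open>The cover is completed at time \<open>n\<close> in \<open>v\<close> exactly if
  \<open>v\<close> alone was missing before.\<close>

lemma last_vertex_event_eq:
  assumes "v \<in> V"
  shows "last_vertex_event G u v = first_hit (V - {v}) {v} v"
proof -
  have "V \<subseteq> \<omega> ` {..n} \<and> \<not> V \<subseteq> \<omega> ` {..<n} \<and> \<omega> n = v \<longleftrightarrow>
      \<omega> n = v \<and> (\<forall>i<n. \<omega> i \<notin> {v}) \<and> V - {v} \<subseteq> \<omega> ` {..<n}" for \<omega> and n :: nat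
  proof -
    have "{..n} = insert n {..<n}" by auto
    then have "\<omega> ` {..n} = insert (\<omega> n) (\<omega> ` {..<n})" by simp
    moreover have "(\<forall>i<n. \<omega> i \<notin> {v}) \<longleftrightarrow> v \<notin> \<omega> ` {..<n}" by auto
    ultimately show ?thesis using assms by auto
  qed
  then show ?thesis
    by (simp add: last_vertex_event_def cover_tour_ends_at_def first_hit_def space_random_walk)
qed

lemma last_prob_eq: "v \<in> V \<Longrightarrow> last_prob u v = measure (walk u) (first_hit (V - {v}) {v} v)"
  by (simp add: last_prob_def last_vertex_event_eq)

text \<open>The second term accounts for continuations from \<open>x\<close> that would leave
  \<open>u\<close> uncovered at the first visit to \<open>v\<close>, had the tour not started at
  \<open>u\<close>.\<close>

lemma last_prob_first_step:
  assumes u: "u \<in> V" and v: "v \<in> V" and neq: "u \<noteq> v"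
  shows "last_prob u v = (\<Sum>x\<in>nbrs u. last_prob x v
    + measure (walk x) (first_hit (V - {u, v}) {u, v} v)) / card (nbrs u)"
proof -
  have "measure (walk x) (case_nat u -` first_hit (V - {v}) {v} v) =
     last_prob x v + measure (walk x) (first_hit (V - {u, v}) {u, v} v)" for x
  proof -
    interpret prob_space "walk x" by (rule prob_space_walk)
    have "case_nat u -` first_hit (V - {v}) {v} v
        = first_hit (V - {v}) {v} v \<union> first_hit (V - {u, v}) {u, v} v"
      using neq by (simp add: vimage_first_hit first_hit_split)
    then show ?thesis
      using finite_measure_Union[OF _ _ first_hit_disjoint[OF u neq]]
      by (simp add: sets_random_walk sets_first_hit last_prob_eq v)
  qed
  then show ?thesis
    using measure_first_step[OF u sets_first_hit[of "V - {v}" "{v}" v]]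
    by (simp add: last_prob_eq v)
qed

lemma finite_E: "finite E"
  by (simp add: arcs_ends_conv)

lemma AE_arcs:
  assumes "u \<in> V"
  shows "AE \<omega> in walk u. \<forall>i. (\<omega> i, \<omega> (Suc i)) \<in> E"
proof -
  let ?X = "\<lambda>i. {\<omega>. (\<omega> i, \<omega> (Suc i)) \<in> E}"
  have X: "?X i \<in> sets traj_algebra" for i
  proof -
    have "?X i = (\<Union>(a, b)\<in>E. {\<omega>. \<omega> i = a} \<inter> {\<omega>. \<omega> (Suc i) = b})" by auto
    also have "\<dots> \<in> sets traj_algebra"
      using finite_E by (auto intro!: sets.finite_UN sets_traj_eq)
    finally show ?thesis .
  qed
  have "measure (walk u) (?X i) = 1" if "u \<in> V" for i u
    using that
  proof (induction i arbitrary: u)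
    case 0
    have "measure (walk x) (case_nat u -` ?X 0) = 1" if "x \<in> nbrs u" for x
    proof -
      interpret prob_space "walk x" by (rule prob_space_walk)
      have "AE \<omega> in walk x. \<omega> \<in> case_nat u -` ?X 0"
        using AE_start by eventually_elim (use that in \<open>simp add: nbrs_iff\<close>)
      then show ?thesis
        using measurable_sets[OF measurable_case_nat_walk X, of u 0 x]
        unfolding space_random_walk Int_UNIV_right by (subst prob_eq_1)
    qed
    then show ?case
      using nbrs_nonempty[OF 0] finite_nbrs by (simp add: measure_first_step[OF 0 X])
  next
    case (Suc i)
    have "case_nat u -` ?X (Suc i) = ?X i" by auto
    then have "measure (walk x) (case_nat u -` ?X (Suc i)) = 1" if "x \<in> nbrs u" for x
      using Suc.IH nbrs_subset that by auto
    then show ?case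
      using nbrs_nonempty[OF Suc.prems] finite_nbrs by (simp add: measure_first_step[OF Suc.prems X])
  qed
  then have "AE \<omega> in walk u. (\<omega> i, \<omega> (Suc i)) \<in> E" for i
    using prob_space.AE_prob_1[OF prob_space_walk] assms by fastforce
  then show ?thesis by (simp add: AE_all_countable)
qed

text \<open>A minimum principle: away from \<open>v\<close> the hitting probability is the average
  over the out-neighbours, so a minimum there is shared by all of them. By strong connectivity the
  minimum is passed on to \<open>v\<close>, where the value is 1.\<close>

lemma hit_prob:
  assumes u: "u \<in> V" and v: "v \<in> V"
  shows "measure (walk u) {\<omega>. \<exists>n. \<omega> n = v} = 1"
proof -
  let ?X = "{\<omega>. \<exists>n. \<omega> n = v}"
  define h where "h x = measure (walk x) ?X" for x
  have X: "?X \<in> sets traj_algebra"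
  proof -
    have "?X = (\<Union>n. {\<omega>. \<omega> n = v})" by auto
    also have "\<dots> \<in> sets traj_algebra"
      by (rule sets.countable_UN) (auto simp: sets_traj_eq)
    finally show ?thesis .
  qed
  have hv: "h v = 1"
  proof -
    interpret prob_space "walk v" by (rule prob_space_walk)
    have "AE \<omega> in walk v. \<omega> \<in> ?X" using AE_start by eventually_elim auto
    then show ?thesis unfolding h_def using X by (subst prob_eq_1) (auto simp: sets_random_walk)
  qed
  have step: "h x = (\<Sum>y\<in>nbrs x. h y) / card (nbrs x)" if x: "x \<in> V" "x \<noteq> v" for x
  proof -
    have "(\<exists>n. case_nat x \<omega> n = v) \<longleftrightarrow> (\<exists>n. \<omega> n = v)" for \<omega>
      using x(2) by (metis nat.case(1) nat.case(2) not0_implies_Suc)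
    then have "case_nat x -` ?X = ?X" by simp
    then show ?thesis unfolding h_def using measure_first_step[OF x(1) X] by simp
  qed
  define m where "m = Min (h ` V)"
  have "V \<noteq> {}" using u by auto
  then have mle: "m \<le> h x" if "x \<in> V" for x using that by (simp add: m_def)
  have "m \<in> h ` V" unfolding m_def using \<open>V \<noteq> {}\<close> by (intro Min_in) auto
  then obtain w where w: "w \<in> V" "h w = m" by auto
  have nbr_min: "h y = m" if x: "x \<in> V" "x \<noteq> v" "h x = m" and y: "y \<in> nbrs x" for x y
  proof (rule ccontr)
    assume "h y \<noteq> m"
    then have "m < h y" using mle y nbrs_subset by fastforce
    then have "(\<Sum>y\<in>nbrs x. m) < (\<Sum>y\<in>nbrs x. h y)"
      using y mle nbrs_subset by (intro sum_strict_mono_ex1 finite_nbrs) auto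
    moreover have "card (nbrs x) > 0" using nbrs_nonempty[OF x(1)] finite_nbrs by (simp add: card_gt_0_iff)
    ultimately show False using step[OF x(1,2)] x(3) by (simp add: field_simps)
  qed
  have "h v = m"
  proof (rule ccontr)
    assume hvm: "h v \<noteq> m"
    have "(w, z) \<in> E\<^sup>* \<Longrightarrow> z \<in> V \<and> h z = m" for z
    proof (induction rule: rtrancl_induct)
      case (step y z)
      then have "y \<noteq> v" using hvm by auto
      then show ?case using step nbr_min[of y z] nbrs_subset by (auto simp: nbrs_iff)
    qed (use w in auto)
    then show False using reach[OF w(1) v] hvm by blast
  qed
  moreover have "h u \<le> 1" unfolding h_def by (rule prob_space.prob_le_1[OF prob_space_walk])
  ultimately have "h u = 1" using mle[OF u] hv by simp
  then show ?thesis by (simp add: h_def)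
qed

text \<open>Almost surely every vertex is hit, so the cover time exists; being determined by the
  trajectory, it makes the events for different final vertices disjoint.\<close>

lemma sum_last_prob:
  assumes u: "u \<in> V"
  shows "(\<Sum>v\<in>V. last_prob u v) = 1"
proof -
  interpret prob_space "walk u" by (rule prob_space_walk)
  let ?L = "last_vertex_event G u"
  have L: "?L v \<in> sets (walk u)" for v by (rule sets_last_vertex_event) simp
  have "disjoint_family_on ?L V"
  proof -
    have False if n: "V \<subseteq> \<omega> ` {..n}" "\<not> V \<subseteq> \<omega> ` {..<n}" and
      m: "V \<subseteq> \<omega> ` {..m}" "\<not> V \<subseteq> \<omega> ` {..<m}" and nm: "n < m" for \<omega> and n m :: nat
      using n(1) m(2) nm image_mono[of "{..n}" "{..<m}" \<omega>] by auto
    then have "v = w" if "\<omega> \<in> ?L v" "\<omega> \<in> ?L w" for \<omega> v w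
      using that unfolding last_vertex_event_def cover_tour_ends_at_def
      by (smt (verit) linorder_neqE_nat mem_Collect_eq)
    then show ?thesis unfolding disjoint_family_on_def by blast
  qed
  then have "(\<Sum>v\<in>V. last_prob u v) = measure (walk u) (\<Union>v\<in>V. ?L v)"
    unfolding last_prob_def using L by (intro finite_measure_finite_Union[symmetric]) auto
  also have "\<dots> = 1"
  proof (subst prob_eq_1)
    show "(\<Union>v\<in>V. ?L v) \<in> sets (walk u)" using L by auto
    have "AE \<omega> in walk u. \<exists>n. \<omega> n = v" if "v \<in> V" for v
      using AE_prob_1[OF hit_prob[OF u that]] by simp
    then have "AE \<omega> in walk u. \<forall>v\<in>V. \<exists>n. \<omega> n = v"
      by (intro AE_finite_allI) auto
    then show "AE \<omega> in walk u. \<omega> \<in> (\<Union>v\<in>V. ?L v)"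
      using AE_in_V[OF u]
    proof eventually_elim
      case (elim \<omega>)
      then obtain t where t: "\<And>v. v \<in> V \<Longrightarrow> \<omega> (t v) = v" by metis
      have "\<exists>n. V \<subseteq> \<omega> ` {..n}"
      proof (intro exI subsetI)
        fix v assume v: "v \<in> V"
        then have "t v \<le> Max (t ` V)" by simp
        with t[OF v] show "v \<in> \<omega> ` {..Max (t ` V)}" by force
      qed
      define n where "n = (LEAST n. V \<subseteq> \<omega> ` {..n})"
      have n: "V \<subseteq> \<omega> ` {..n}"
        unfolding n_def by (rule LeastI_ex) fact
      have min: "\<not> V \<subseteq> \<omega> ` {..m}" if "m < n" for m
        using not_less_Least[OF that[unfolded n_def]] .
      have "\<not> V \<subseteq> \<omega> ` {..<n}"
      proof (cases n)
        case 0
        then show ?thesis using u by auto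
      next
        case (Suc m)
        then show ?thesis using min[of m] by (simp add: lessThan_Suc_atMost)
      qed
      with n have "\<omega> \<in> ?L (\<omega> n)"
        by (auto simp: last_vertex_event_def cover_tour_ends_at_def space_random_walk)
      then show ?case using elim by blast
    qed
  qed
  finally show ?thesis .
qed

text \<open>The first visit to \<open>u\<close> is at time 0, when some other vertex is still
  missing.\<close>

lemma last_prob_self:
  assumes u: "u \<in> V"
  shows "last_prob u u = 0"
proof -
  interpret prob_space "walk u" by (rule prob_space_walk)
  obtain w where w: "w \<in> V" "w \<noteq> u" by (rule ex_other_vertex)
  have "AE \<omega> in walk u. \<omega> \<notin> first_hit (V - {u}) {u} u"
    using AE_start
  proof eventually_elim
    case (elim \<omega>)
    show ?case
    proof
      assume "\<omega> \<in> first_hit (V - {u}) {u} u"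
      then obtain n where n: "\<forall>i<n. \<omega> i \<noteq> u" "V - {u} \<subseteq> \<omega> ` {..<n}"
        by (auto simp: first_hit_def)
      with elim have "n = 0" by auto
      with n(2) w show False by auto
    qed
  qed
  then show ?thesis
    unfolding last_prob_eq[OF u] by (subst prob_eq_0) (auto simp: sets_random_walk sets_first_hit)
qed

text \<open>An event of positive probability contains a trajectory that starts at \<open>x\<close>
  and follows arcs, and its piece before the hit is the walk. Conversely, a finite walk determines a
  cylinder of positive probability inside the event.\<close>

lemma prob_first_hit_nonzero_iff:
  assumes x: "x \<in> V" and v: "v \<in> V" and ne: "V - {u, v} \<noteq> {}"
  shows "measure (walk x) (first_hit (V - {u, v}) {u, v} v) \<noteq> 0 \<longleftrightarrow>
    (\<exists>y. walk_on E (V - {u, v}) x y (V - {u, v}) \<and> (y, v) \<in> E)"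
proof
  interpret prob_space "walk x" by (rule prob_space_walk)
  let ?S = "V - {u, v}" and ?F = "first_hit (V - {u, v}) {u, v} v"
  have F: "?F \<in> sets (walk x)" by (simp add: sets_random_walk sets_first_hit)
  assume "measure (walk x) ?F \<noteq> 0"
  then have not_AE: "\<not> (AE \<omega> in walk x. \<omega> \<notin> ?F)" using prob_eq_0[OF F] by simp
  obtain \<omega> where w: "\<omega> \<in> ?F" "\<omega> 0 = x" "\<forall>i. \<omega> i \<in> V" "\<forall>i. (\<omega> i, \<omega> (Suc i)) \<in> E"
  proof (rule ccontr)
    assume no: "\<not> thesis"
    have "AE \<omega> in walk x. \<omega> \<notin> ?F"
      using AE_start AE_in_V[OF x] AE_arcs[OF x]
    proof eventually_elim
      case (elim \<omega>)
      show ?case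
      proof
        assume "\<omega> \<in> ?F"
        from this elim have thesis by (rule that)
        with no show False by contradiction
      qed
    qed
    with not_AE show False by contradiction
  qed
  from w(1) obtain n where n: "\<omega> n = v" "\<forall>i<n. \<omega> i \<notin> {u, v}" "?S \<subseteq> \<omega> ` {..<n}"
    by (auto simp: first_hit_def)
  \<comment> \<open>Something has to be covered first, so the hit is not at time 0 and
    \<open>\<omega> m\<close> is the vertex from which \<open>v\<close> is entered.\<close>
  obtain m where m: "n = Suc m" using n(3) ne by (cases n) auto
  have "walk_on E ?S (\<omega> 0) (\<omega> m) (\<omega> ` {..m})"
    using n w m by (intro walk_on_seqI) auto
  moreover have "\<omega> ` {..m} = ?S"
  proof
    show "?S \<subseteq> \<omega> ` {..m}" using n(3) m by (simp add: lessThan_Suc_atMost)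
    show "\<omega> ` {..m} \<subseteq> ?S"
    proof (rule image_subsetI)
      fix i assume "i \<in> {..m}"
      then have "\<omega> i \<notin> {u, v}" using n(2) m by (simp add: less_Suc_eq_le)
      then show "\<omega> i \<in> ?S" using w(3) by simp
    qed
  qed
  ultimately show "\<exists>y. walk_on E ?S x y ?S \<and> (y, v) \<in> E"
    using w(2) w(4)[rule_format, of m] n(1) m by auto
next
  interpret prob_space "walk x" by (rule prob_space_walk)
  let ?S = "V - {u, v}" and ?F = "first_hit (V - {u, v}) {u, v} v"
  assume "\<exists>y. walk_on E ?S x y ?S \<and> (y, v) \<in> E"
  then obtain y where y: "walk_on E ?S x y ?S" "(y, v) \<in> E" by blast
  obtain \<omega> and m :: nat where w: "\<omega> 0 = x" "\<omega> m = y" "\<omega> ` {..m} = ?S"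
    "\<And>i. i < m \<Longrightarrow> (\<omega> i, \<omega> (Suc i)) \<in> E" "\<And>i. i \<le> m \<Longrightarrow> \<omega> i \<in> ?S"
    using walk_on_seqE[OF y(1)] by metis
  define \<rho> where "\<rho> = fun_upd \<omega> (Suc m) v"
  let ?C = "{\<omega>. \<forall>i\<le>Suc m. \<omega> i = \<rho> i}"
  have "?C \<subseteq> ?F"
  proof
    fix \<psi> assume "\<psi> \<in> ?C"
    then have p: "\<psi> i = \<omega> i" if "i \<le> m" for i using that by (auto simp: \<rho>_def)
    have "\<psi> (Suc m) = v" using \<open>\<psi> \<in> ?C\<close> by (auto simp: \<rho>_def)
    moreover have "\<psi> ` {..<Suc m} = ?S"
      using p w(3) by (auto simp: lessThan_Suc_atMost image_def)
    ultimately show "\<psi> \<in> ?F"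
      using w(5) p unfolding first_hit_def mem_Collect_eq
      by (intro exI[of _ "Suc m"]) (auto simp: less_Suc_eq_le)
  qed
  then have "measure (walk x) ?C \<le> measure (walk x) ?F"
    by (intro finite_measure_mono) (auto simp: sets_random_walk sets_first_hit)
  moreover have "measure (walk x) ?C = (\<Prod>i<Suc m. pmf (walk_step G (\<rho> i)) (\<rho> (Suc i)))"
    using w(1) unfolding measure_def emeasure_random_walk_path
    by (simp add: \<rho>_def prod_nonneg del: prod.lessThan_Suc)
  moreover have "\<dots> > 0"
  proof (rule prod_pos)
    fix i assume "i \<in> {..<Suc m}"
    then have i: "i \<le> m" by auto
    have "(\<rho> i, \<rho> (Suc i)) \<in> E" using i w(2,4) y(2) by (auto simp: \<rho>_def)
    then have "\<rho> (Suc i) \<in> set_pmf (walk_step G (\<rho> i))"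
      using adj_in_verts by (auto simp: set_walk_step nbrs_iff)
    then show "pmf (walk_step G (\<rho> i)) (\<rho> (Suc i)) > 0" by (rule pmf_positive)
  qed
  ultimately show "measure (walk x) ?F \<noteq> 0" by linarith
qed

end

section \<open>From uniform final vertices to the covering-walk criterion\<close>

locale uniform_cover_digraph = connected_digraph +
  assumes three_verts: "3 \<le> card V"
    and uniform: "\<lbrakk>u \<in> V; v \<in> V; w \<in> V; u \<noteq> v; u \<noteq> w; v \<noteq> w\<rbrakk> \<Longrightarrow>
      last_prob u v = last_prob u w"
begin

lemma uniform_last_prob:
  assumes u: "u \<in> V" and v: "v \<in> V" and neq: "u \<noteq> v"
  shows "last_prob u v = 1 / (real (card V) - 1)"
proof -
  have "1 = (\<Sum>w\<in>V. last_prob u w)" using sum_last_prob[OF u] by simp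
  also have "\<dots> = (\<Sum>w\<in>V - {u}. last_prob u w)"
    using u by (simp add: sum.remove[of V u] last_prob_self)
  also have "\<dots> = (\<Sum>w\<in>V - {u}. last_prob u v)"
    using uniform[OF u v _ neq] by (intro sum.cong refl) fastforce
  also have "\<dots> = (real (card V) - 1) * last_prob u v"
    using u two_verts by (simp add: of_nat_diff)
  finally show ?thesis using two_verts by (simp add: field_simps)
qed

lemma arc_iff_covering_walk:
  assumes u: "u \<in> V" and v: "v \<in> V" and neq: "u \<noteq> v"
  shows "(u, v) \<in> E \<longleftrightarrow>
    (\<exists>x y. (u, x) \<in> E \<and> walk_on E (V - {u, v}) x y (V - {u, v}) \<and> (y, v) \<in> E)"
proof -
  define q where "q x = measure (walk x) (first_hit (V - {u, v}) {u, v} v)" for x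
  let ?c = "1 / (real (card V) - 1)" and ?d = "card (nbrs u)"
  have d: "?d > 0" using nbrs_nonempty[OF u] finite_nbrs by (simp add: card_gt_0_iff)
  have "?c * ?d = (\<Sum>x\<in>nbrs u. last_prob x v) + (\<Sum>x\<in>nbrs u. q x)"
    using last_prob_first_step[OF u v neq] d uniform_last_prob[OF u v neq]
    by (simp add: q_def sum.distrib field_simps)
  \<comment> \<open>Each out-neighbour contributes \<open>?c\<close>, except \<open>v\<close>
    itself, which contributes 0. This deficit, present iff there is an arc from \<open>u\<close> to
    \<open>v\<close>, must be made up by the sum of \<open>q\<close>.\<close>
  also have "(\<Sum>x\<in>nbrs u. last_prob x v) = (\<Sum>x\<in>nbrs u. ?c - (if x = v then ?c else 0))"
    using nbrs_subset v uniform_last_prob last_prob_self by (intro sum.cong refl) auto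
  also have "\<dots> = ?d * ?c - (if v \<in> nbrs u then ?c else 0)"
    using finite_nbrs by (simp add: sum_subtractf)
  finally have sum_q: "(\<Sum>x\<in>nbrs u. q x) = (if v \<in> nbrs u then ?c else 0)"
    by (simp add: algebra_simps)
  have "?c > 0" using three_verts by simp
  then have "v \<in> nbrs u \<longleftrightarrow> (\<Sum>x\<in>nbrs u. q x) \<noteq> 0" unfolding sum_q by simp
  also have "\<dots> \<longleftrightarrow> (\<exists>x\<in>nbrs u. q x \<noteq> 0)"
    using finite_nbrs by (subst sum_nonneg_eq_0_iff) (auto simp: q_def)
  also have "\<dots> \<longleftrightarrow> (\<exists>x\<in>nbrs u. \<exists>y. walk_on E (V - {u, v}) x y (V - {u, v}) \<and> (y, v) \<in> E)"
  proof -
    have "\<not> V \<subseteq> {u, v}" using three_verts card_mono[of "{u, v}" V] neq by auto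
    then have "V - {u, v} \<noteq> {}" by auto
    then have "q x \<noteq> 0 \<longleftrightarrow> (\<exists>y. walk_on E (V - {u, v}) x y (V - {u, v}) \<and> (y, v) \<in> E)"
      if "x \<in> nbrs u" for x
      unfolding q_def using that nbrs_subset v by (intro prob_first_hit_nonzero_iff) auto
    then show ?thesis by (intro bex_cong refl)
  qed
  finally show ?thesis by (auto simp: nbrs_iff)
qed

end

lemma complete_digraphI:
  assumes "digraph G" "arcs_ends G = {(u, v). (u, v) \<in> verts G \<times> verts G \<and> u \<noteq> v}"
  shows "complete_digraph (card (verts G)) G"
proof -
  interpret digraph G by fact
  have "symmetric G" using assms(2) by (auto simp: symmetric_def sym_def)
  then have "graph G" by unfold_locales
  then show ?thesis using assms(2) by (simp add: complete_digraph_def)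
qed

lemma (in connected_digraph) two_verts_complete:
  assumes "card V = 2"
  shows "E = {(u, v). (u, v) \<in> V \<times> V \<and> u \<noteq> v}"
proof -
  have "(u, v) \<in> E" if uv: "u \<in> V" "v \<in> V" "u \<noteq> v" for u v
  proof -
    have "V = {u, v}" using card_subset_eq[of V "{u, v}"] uv assms by auto
    then show ?thesis using nbrs_nonempty[OF uv(1)] nbrs_subset[of u] not_self_nbr[of u]
      by (auto simp: nbrs_iff)
  qed
  then show ?thesis by (auto dest: adj_in_verts adj_not_same)
qed

theorem mainTheorem2:
  fixes G :: "('a, 'b) pre_digraph"
  assumes "digraph G"
    and "strongly_connected G"
    and "\<And>u v w. \<lbrakk>u \<in> verts G; v \<in> verts G; w \<in> verts G; u \<noteq> v; u \<noteq> w; v \<noteq> w\<rbrakk> \<Longrightarrow>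
           measure (random_walk G u) (last_vertex_event G u v) =
           measure (random_walk G u) (last_vertex_event G u w)"
  shows "bidirected_cycle G \<or> (\<exists>n\<ge>1. complete_digraph n G)"
proof -
  interpret G: digraph G by fact
  let ?V = "verts G" and ?E = "arcs_ends G"
  have ne: "?V \<noteq> {}" using assms(2) by (simp add: strongly_connected_def)
  then have card1: "1 \<le> card ?V" by (simp add: Suc_le_eq card_gt_0_iff)
  have complete: ?thesis if "\<And>u v. \<lbrakk>u \<in> ?V; v \<in> ?V; u \<noteq> v\<rbrakk> \<Longrightarrow> (u, v) \<in> ?E"
  proof -
    have "?E = {(u, v). (u, v) \<in> ?V \<times> ?V \<and> u \<noteq> v}"
      using that by (auto dest: G.adj_in_verts G.adj_not_same)
    then show ?thesis using complete_digraphI[OF assms(1)] card1 by blast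
  qed
  \<comment> \<open>Graphs with at most two vertices are complete for elementary reasons; from three
    vertices on, the covering-walk criterion is available.\<close>
  consider "card ?V = 1" | "card ?V = 2" | "3 \<le> card ?V" using card1 by linarith
  then show ?thesis
  proof cases
    case 1
    then show ?thesis by (intro complete) (auto simp: card_1_singleton_iff)
  next
    case 2
    then interpret connected_digraph G using assms(2) by unfold_locales auto
    show ?thesis using two_verts_complete[OF 2] by (intro complete) auto
  next
    case 3
    then interpret connected_digraph G using assms(2) by unfold_locales auto
    interpret uniform_cover_digraph G
    proof unfold_locales
      show "last_prob u v = last_prob u w"
        if "u \<in> ?V" "v \<in> ?V" "w \<in> ?V" "u \<noteq> v" "u \<noteq> w" "v \<noteq> w" for u v w
        unfolding last_prob_def by (rule assms(3)[OF that])
    qed (rule 3)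
    interpret covering_digraph ?V ?E
    proof
      show "\<exists>v. (u, v) \<in> ?E" if "u \<in> ?V" for u
        using nbrs_nonempty[OF that] by (auto simp: nbrs_iff)
      show "?E \<subseteq> ?V \<times> ?V" by (auto dest: G.adj_in_verts)
      show "(x, x) \<notin> ?E" for x by (auto dest: G.adj_not_same)
    qed (use 3 arc_iff_covering_walk in simp_all)
    show ?thesis
    proof (cases "\<forall>u\<in>?V. \<forall>v\<in>?V. u \<noteq> v \<longrightarrow> (u, v) \<in> ?E")
      case True
      then show ?thesis by (intro complete) auto
    next
      case False
      then have "bidirected_cycle G"
        using cycle_if_not_complete assms(1) unfolding bidirected_cycle_def by blast
      then show ?thesis ..
    qed
  qed
qed

end
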